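(* Let the setting be as in the context, with $0<\sigma<\infty$ and $g\in C^{0,1}(\partial\Omega)$ with $L\le\sigma$. Let $f\equiv\lambda$ be constant ($\lambda\in\mathbb{R}$), assume that there exists $\bar g\in S_g$ with $F(\bar g)<+\infty$, and let $u$ be the minimizer of $F$ on $S_g$. Define the boundary-to-interior slope $$S:=\sup\Big\{\frac{|u(x)-g(y)|}{|x-y|}\ :\ x\in\Omega,\ y\in\partial\Omega,\ x\neq y\Big\}.$$ Then $$\operatorname{Lip}(u,\Omega)=S .$$ In particular, if $S<\sigma$ then $u$ is a weak solution of $-\sum_{p=2}^\infty a_p\Delta_pu=f$ in $\Omega$, $u=g$ on $\partial\Omega$.
   Context: $\Omega\subset\mathbb{R}^N$ ($N\ge1$) is a bounded, connected, open set with Lipschitz boundary (no convexity is assumed). $\{a_p\}_{p\ge2}$ ($p$ integer) is a real sequence with $a_p\ge0$ for all $p$, $a_2>0$, and $a_p\ne0$ for infinitely many $p$; $\sigma$ is defined by $1/\sigma=\limsup_{p\to\infty}a_p^{1/p}$. Put $\Phi(t)=\sum_{p\ge2}\frac{a_p}{p}t^p\in[0,+\infty]$ for $t\in[0,\sigma]$, and $G(\xi)=\Phi(|\xi|)$ if $|\xi|\le\sigma$, $G(\xi)=+\infty$ if $|\xi|>\sigma$. For $g\in C^{0,1}(\partial\Omega)$ put $L=\sup_{x\ne y\in\partial\Omega}\frac{|g(x)-g(y)|}{|x-y|}$ and $S_g=\{v\in C^{0,1}(\overline\Omega):\ \|\nabla v\|_{L^\infty(\Omega)}\le\sigma,\ v=g\text{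 on }\partial\Omega\}$; for $v\in S_g$, $F(v)=\int_\Omega G(\nabla v)-\int_\Omega fv\in(-\infty,+\infty]$. Under the stated assumptions $F$ has a unique minimizer on $S_g$. $\operatorname{Lip}(u,\Omega)=\sup_{x\ne y\in\Omega}\frac{|u(x)-u(y)|}{|x-y|}$. Here $\Delta_pu=\operatorname{div}(|\nabla u|^{p-2}\nabla u)$. A function $u\in S_g$ is a weak solution of the Dirichlet problem if $\sum_{p=2}^{\infty}a_p\int_\Omega|\nabla u|^{p-2}\nabla u\cdot\nabla\psi=\int_\Omega f\psi$ for every $\psi\in W^{1,\infty}_0(\Omega)$ (Lipschitz functions on $\overline\Omega$ vanishing on $\partial\Omega$) for which the series on the left is absolutely convergent, i.e. $\sum_pa_p\big|\int_\Omega|\nabla u|^{p-2}\nabla u\cdot\nabla\psi\big|<\infty$. *)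

theory Defs
  imports "HOL-Analysis.Analysis"
begin

text \<open>The ambient space \<open>\<real>\<^sup>N\<close>, \<open>N \<ge> 1\<close>, is an arbitrary type of class \<open>euclidean_space\<close>.
  Functions on \<open>closure \<Omega>\<close> or \<open>frontier \<Omega>\<close> are total functions whose values outside that
  set are irrelevant.\<close>

text \<open>Near every boundary point, \<open>\<Omega>\<close> is the strict epigraph of a Lipschitz function \<open>\<gamma>\<close>
  over the hyperplane orthogonal to some unit vector \<open>e\<close> (the local vertical axis).\<close>

definition lipschitz_boundary :: "'a::euclidean_space set \<Rightarrow> bool" where
  "lipschitz_boundary \<Omega> \<longleftrightarrow>
     (\<forall>z\<in>frontier \<Omega>. \<exists>r>0. \<exists>e \<gamma> C. norm e = 1 \<and> C-lipschitz_on {y. y \<bullet> e = 0} \<gamma> \<and>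
        \<Omega> \<inter> ball z r = {x \<in> ball z r. \<gamma> (x - (x \<bullet> e) *\<^sub>R e) < x \<bullet> e})"

text \<open>\<open>C\<^sup>0\<^sup>,\<^sup>1(A)\<close>\<close>

definition lipschitz_fun :: "'a::euclidean_space set \<Rightarrow> ('a \<Rightarrow> real) \<Rightarrow> bool" where
  "lipschitz_fun A v \<longleftrightarrow> (\<exists>C. C-lipschitz_on A v)"

text \<open>The suprema are taken in the extended reals, so no boundedness has to be
  presupposed. \<open>Lip_const (frontier \<Omega>) g\<close> is \<open>L\<close> and \<open>Lip_const \<Omega> u\<close> is \<open>Lip(u,\<Omega>)\<close>.\<close>

definition Lip_const :: "'a::euclidean_space set \<Rightarrow> ('a \<Rightarrow> real) \<Rightarrow> ereal" where
  "Lip_const A v = Sup {ereal (\<bar>v x - v y\<bar> / norm (x - y)) | x y. x \<in> A \<and> y \<in> A \<and> x \<noteq> y}"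

definition boundary_slope ::
    "'a::euclidean_space set \<Rightarrow> ('a \<Rightarrow> real) \<Rightarrow> ('a \<Rightarrow> real) \<Rightarrow> ereal" where
  "boundary_slope \<Omega> g u =
     Sup {ereal (\<bar>u x - g y\<bar> / norm (x - y)) | x y. x \<in> \<Omega> \<and> y \<in> frontier \<Omega> \<and> x \<noteq> y}"

text \<open>The pointwise gradient. A Lipschitz function on an open set is differentiable almost
  everywhere (Rademacher) and its pointwise gradient is its weak gradient, so the
  value \<open>0\<close> chosen at points of non-differentiability is immaterial.\<close>

definition grad :: "('a::euclidean_space \<Rightarrow> real) \<Rightarrow> 'a \<Rightarrow> 'a" where
  "grad v x = (if \<exists>D. GDERIV v x :> D then THE D. GDERIV v x :> D else 0)"

text \<open>The coefficients \<open>a\<^sub>p\<close> are used only for \<open>p \<ge> 2\<close>; a series over \<open>p \<ge> 2\<close> is written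
  as a series over all naturals with \<open>p + 2\<close> in place of \<open>p\<close>.\<close>

definition Phi :: "(nat \<Rightarrow> real) \<Rightarrow> real \<Rightarrow> ennreal" where
  "Phi a t = (\<Sum>p. ennreal (a (p + 2) / real (p + 2) * t ^ (p + 2)))"

definition G_energy :: "(nat \<Rightarrow> real) \<Rightarrow> real \<Rightarrow> 'a::euclidean_space \<Rightarrow> ennreal" where
  "G_energy a \<sigma> \<xi> = (if norm \<xi> \<le> \<sigma> then Phi a (norm \<xi>) else \<infinity>)"

definition admissible ::
    "'a::euclidean_space set \<Rightarrow> real \<Rightarrow> ('a \<Rightarrow> real) \<Rightarrow> ('a \<Rightarrow> real) set" where
  "admissible \<Omega> \<sigma> g =
     {v. lipschitz_fun (closure \<Omega>) v \<and> (AE x in lebesgue_on \<Omega>. norm (grad v x) \<le> \<sigma>) \<and>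
         (\<forall>x\<in>frontier \<Omega>. v x = g x)}"

definition F_energy ::
    "(nat \<Rightarrow> real) \<Rightarrow> real \<Rightarrow> 'a::euclidean_space set \<Rightarrow> ('a \<Rightarrow> real) \<Rightarrow> ('a \<Rightarrow> real) \<Rightarrow> ereal"
  where
  "F_energy a \<sigma> \<Omega> f v =
     enn2ereal (\<integral>\<^sup>+x. G_energy a \<sigma> (grad v x) \<partial>lebesgue_on \<Omega>)
       - ereal (\<integral>x. f x * v x \<partial>lebesgue_on \<Omega>)"

definition is_minimizer ::
    "(nat \<Rightarrow> real) \<Rightarrow> real \<Rightarrow> 'a::euclidean_space set \<Rightarrow> ('a \<Rightarrow> real) \<Rightarrow> ('a \<Rightarrow> real) \<Rightarrow>
      ('a \<Rightarrow> real) \<Rightarrow> bool" where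
  "is_minimizer a \<sigma> \<Omega> f g u \<longleftrightarrow>
     u \<in> admissible \<Omega> \<sigma> g \<and>
     (\<forall>v\<in>admissible \<Omega> \<sigma> g. F_energy a \<sigma> \<Omega> f u \<le> F_energy a \<sigma> \<Omega> f v)"

definition p_form :: "nat \<Rightarrow> 'a::euclidean_space set \<Rightarrow> ('a \<Rightarrow> real) \<Rightarrow> ('a \<Rightarrow> real) \<Rightarrow> real" where
  "p_form p \<Omega> u \<psi> =
     (\<integral>x. norm (grad u x) ^ (p - 2) * (grad u x \<bullet> grad \<psi> x) \<partial>lebesgue_on \<Omega>)"

definition weak_solution ::
    "(nat \<Rightarrow> real) \<Rightarrow> real \<Rightarrow> 'a::euclidean_space set \<Rightarrow> ('a \<Rightarrow> real) \<Rightarrow> ('a \<Rightarrow> real) \<Rightarrow>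
      ('a \<Rightarrow> real) \<Rightarrow> bool" where
  "weak_solution a \<sigma> \<Omega> f g u \<longleftrightarrow>
     u \<in> admissible \<Omega> \<sigma> g \<and>
     (\<forall>\<psi>. lipschitz_fun (closure \<Omega>) \<psi> \<longrightarrow> (\<forall>x\<in>frontier \<Omega>. \<psi> x = 0) \<longrightarrow>
        summable (\<lambda>p. a (p + 2) * \<bar>p_form (p + 2) \<Omega> u \<psi>\<bar>) \<longrightarrow>
        (\<Sum>p. a (p + 2) * p_form (p + 2) \<Omega> u \<psi>) = (\<integral>x. f x * \<psi> x \<partial>lebesgue_on \<Omega>))"

end

theory Submission
  imports Defs
begin

text \<open>Every Lipschitz function is differentiable a.e. (Rademacher), so the gradients of glued and
  translated competitors can be computed pointwise. For a shift \<open>\<tau>\<close> put \<open>M = S |\<tau>|\<close> and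
  \<open>w = max 0 (u (\<cdot> + \<tau>) - M - u)\<close> on \<open>\<Omega> \<inter> (\<Omega> - \<tau>)\<close>. At a boundary point of this set one of \<open>x\<close>,
  \<open>x + \<tau>\<close> lies on the boundary of \<open>\<Omega>\<close>, so \<open>w\<close> vanishes there. Since the load is constant, the
  competitors \<open>u + w\<close> and \<open>u - w (\<cdot> - \<tau>)\<close> together have the energy \<open>2 F u\<close>; both therefore
  minimize, and uniqueness gives \<open>w = 0\<close>, that is \<open>u (x + \<tau>) - u x \<le> S |\<tau>|\<close>. If \<open>S < \<sigma>\<close>, the
  gradients stay in a ball on which the energy density is smooth, so \<open>u\<close> can be varied freely in
  both directions.\<close>

section \<open>Lipschitz functions on the line\<close>

text \<open>Without convexity a segment between two interior points may leave \<Omega>, so slopes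
  cannot be compared along segments; translation needs only the overlap of \<Omega> with its shift.
  The gluing is admissible because the constraint bounds the gradient almost everywhere and not the
  Lipschitz constant: each competitor has, almost everywhere, the gradient of \<open>u\<close> at
  the point itself or at the shifted point. The boundary of {w > 0} may have positive measure, but
  \<open>w\<close> is nonnegative and almost everywhere differentiable, so its gradient vanishes at
  almost every zero.

  \<open>Phi\<close> may be infinite or have infinite slope at \<sigma>, so no Euler-Lagrange
  equation is at hand for the comparison. It only redistributes energy between a set and its
  translate, and finiteness of \<open>F u\<close> is what permits the cancellation. A strict
  inequality S < \<sigma> leaves room to differentiate: all slopes then lie below a radius inside
  the disc of convergence of the power series.\<close>

text \<open>\<open>F x = f x + (C + 1) x\<close> is a bi-Lipschitz bijection, so the image of Lebesgue measure under
  \<open>inv F\<close> is absolutely continuous. Hence \<open>F\<close> is an indefinite integral, and Lebesgue's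
  differentiation theorem, used for \<open>k x\<close> and \<open>k (- x)\<close>, gives the two one-sided derivatives.\<close>

lemma Lipschitz_real_AE_differentiable:
  fixes f :: "real \<Rightarrow> real"
  assumes f: "C-lipschitz_on UNIV f"
  shows "AE x in lborel. f differentiable (at x)"
proof -
  have C: "C \<ge> 0" using f by (rule lipschitz_on_nonneg)
  \<comment> \<open>The slope \<open>C + 1\<close> outweighs the slope \<open>C\<close> of
    \<open>f\<close> by 1, so \<open>F\<close> expands distances and its inverse is
    1-Lipschitz.\<close>
  define F where "F x = f x + (C + 1) * x" for x
  have fC: "\<bar>f x - f y\<bar> \<le> C * \<bar>x - y\<bar>" for x y
    using lipschitz_onD[OF f, of x y] by (simp add: dist_real_def)
  have Fgrow: "F y - F x \<ge> y - x" if "x \<le> y" for x y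
  proof -
    have "f x - f y \<le> C * (y - x)" using fC[of x y] that by (auto simp: abs_if split: if_splits)
    then show ?thesis by (simp add: F_def algebra_simps)
  qed
  have Fless: "F x < F y \<longleftrightarrow> x < y" for x y
    using Fgrow[of x y] Fgrow[of y x] by (cases "x < y") auto
  have Fle: "F x \<le> F y \<longleftrightarrow> x \<le> y" for x y
    using Fless[of y x] by linarith
  have Flip: "\<bar>F x - F y\<bar> \<le> (2 * C + 1) * \<bar>x - y\<bar>" for x y
  proof -
    have "F x - F y = (f x - f y) + (C + 1) * (x - y)" by (simp add: F_def algebra_simps)
    then have "\<bar>F x - F y\<bar> \<le> \<bar>f x - f y\<bar> + \<bar>(C + 1) * (x - y)\<bar>" by linarith
    also have "\<bar>(C + 1) * (x - y)\<bar> = (C + 1) * \<bar>x - y\<bar>" using C by (simp add: abs_mult)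
    finally show ?thesis using fC[of x y] by (simp add: algebra_simps)
  qed
  have contf: "continuous_on UNIV f" using lipschitz_on_continuous_on[OF f] .
  have contF: "continuous_on UNIV F" unfolding F_def by (intro continuous_intros contf)
  have surjF: "\<exists>x. F x = y" for y
  proof -
    have 1: "F (- \<bar>y - F 0\<bar>) \<le> y" using Fgrow[of "- \<bar>y - F 0\<bar>" 0] by linarith
    have 2: "y \<le> F \<bar>y - F 0\<bar>" using Fgrow[of 0 "\<bar>y - F 0\<bar>"] by linarith
    show ?thesis
      using IVT'[OF 1 2 _ continuous_on_subset[OF contF]] by auto
  qed
  have injF: "inj F" using Fless by (intro injI) (metis less_irrefl neq_iff)
  define G where "G = inv F"
  have FG [simp]: "F (G y) = y" for y unfolding G_def using surjF[of y] by (auto intro!: f_inv_into_f)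
  have GF [simp]: "G (F y) = y" for y unfolding G_def by (simp add: injF)
  have Glip: "\<bar>G x - G y\<bar> \<le> \<bar>x - y\<bar>" for x y
    using Fgrow[of "G x" "G y"] Fgrow[of "G y" "G x"] by (auto simp: abs_if)
  have contG: "continuous_on UNIV G"
    by (intro lipschitz_on_continuous_on[of 1] lipschitz_onI) (auto simp: dist_real_def Glip)
  have G_meas [measurable]: "G \<in> borel_measurable borel" using contG by (rule borel_measurable_continuous_onI)
  define \<mu> where "\<mu> = distr lborel borel G"
  have emu: "emeasure \<mu> A = emeasure lborel (F ` A)" if "A \<in> sets borel" for A
  proof -
    have "G -` A = F ` A" by (auto simp: image_iff intro!: bexI[of _ "G _"])
    then show ?thesis using that by (simp add: \<mu>_def emeasure_distr)
  qed
  \<comment> \<open>By \<open>emu\<close>, \<mu> measures a Borel set by the length of its image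
    under \<open>F\<close>, and Lipschitz maps send null sets to null sets.\<close>
  have "absolutely_continuous lborel \<mu>"
    unfolding absolutely_continuous_def
  proof
    fix A :: "real set" assume A: "A \<in> null_sets lborel"
    then have [measurable]: "A \<in> sets borel" by auto
    have "negligible A" using A by (simp add: negligible_iff_null_sets null_sets_completionI)
    then have "negligible (F ` A)"
    proof (rule negligible_locally_Lipschitz_image[rotated])
      show "\<exists>T B. open T \<and> x \<in> T \<and> (\<forall>y \<in> A \<inter> T. norm (F y - F x) \<le> B * norm (y - x))" for x
        using Flip by (intro exI[of _ UNIV] exI[of _ "2 * C + 1"]) auto
    qed auto
    moreover have "F ` A = G -` A" by (auto simp: image_iff intro!: bexI[of _ "G _"])
    then have "F ` A \<in> sets borel" using measurable_sets[OF G_meas, of A] by simp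
    ultimately have "F ` A \<in> null_sets lborel"
      using null_sets_completion_iff[of "F ` A" lborel] by (simp add: negligible_iff_null_sets)
    then show "A \<in> null_sets \<mu>"
      using emu[of A] by (intro null_setsI) (auto simp: \<mu>_def dest: null_setsD1)
  qed
  then obtain h where h [measurable]: "h \<in> borel_measurable lborel" and hmu: "density lborel h = \<mu>"
    using sigma_finite_measure.Radon_Nikodym[OF sigma_finite_lborel, of \<mu>] by (auto simp: \<mu>_def)
  \<comment> \<open>The density may be infinite on a null set; \<open>enn2real\<close> puts 0
    there.\<close>
  define k where "k x = enn2real (h x)" for x
  have k_meas [measurable]: "k \<in> borel_measurable borel" unfolding k_def using h by measurable
  have kint: "(k has_integral (F b - F a)) (cbox a b)" if "a \<le> b" for a b
  proof -
    have im: "F ` {a..b} = {F a..F b}"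
    proof
      show "{F a..F b} \<subseteq> F ` {a..b}"
      proof
        fix y assume "y \<in> {F a..F b}"
        then have "G y \<in> {a..b}" using Fle[of a "G y"] Fle[of "G y" b] by simp
        then show "y \<in> F ` {a..b}" by (intro image_eqI[of _ F "G y"]) simp_all
      qed
    qed (auto simp: Fle)
    have "(\<integral>\<^sup>+x. h x * indicator {a..b} x \<partial>lborel) = emeasure \<mu> {a..b}"
      by (simp add: hmu[symmetric] emeasure_density)
    also have "\<dots> = ennreal (F b - F a)" using that im by (simp add: emu Fle)
    finally have 1: "(\<integral>\<^sup>+x. h x * indicator {a..b} x \<partial>lborel) = ennreal (F b - F a)" .
    have "AE x in lborel. h x * indicator {a..b} x \<noteq> \<infinity>"
      by (rule nn_integral_PInf_AE) (use 1 in auto)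
    then have "(\<integral>\<^sup>+x. ennreal (k x * indicator {a..b} x) \<partial>lborel) = (\<integral>\<^sup>+x. h x * indicator {a..b} x \<partial>lborel)"
      by (intro nn_integral_cong_AE) (auto simp: k_def indicator_def less_top elim!: eventually_mono)
    then have "((\<lambda>x. k x * indicator {a..b} x) has_integral (F b - F a)) UNIV"
      using 1 that by (intro nn_integral_has_integral) (auto simp: k_def Fle)
    then have "((\<lambda>x. if x \<in> cbox a b then k x else 0) has_integral (F b - F a)) UNIV"
      by (rule has_integral_eq[rotated]) auto
    then show ?thesis using has_integral_restrict_UNIV by blast
  qed
  have i1: "k integrable_on cbox a b" for a b
    using kint[of a b] by (cases "a \<le> b") auto
  \<comment> \<open>The differentiation theorem averages over cubes with lower corner at the point,
    that is, to its right; the reflected density supplies the averages to the left.\<close>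
  have kint2: "((\<lambda>x. k (- x)) has_integral (F (- a) - F (- b))) (cbox a b)" if "a \<le> b" for a b
    using has_integral_reflect_real[where f = k and i = "F (- a) - F (- b)" and a = "- b" and b = "- a"] kint[of "-b" "-a"] that by simp
  have i2: "(\<lambda>x. k (- x)) integrable_on cbox a b" for a b
    using kint2[of a b] by (cases "a \<le> b") auto
  obtain N1 where N1: "negligible N1"
    "\<And>x e. \<lbrakk>x \<notin> N1; 0 < e\<rbrakk> \<Longrightarrow> \<exists>d>0. \<forall>h. 0 < h \<and> h < d \<longrightarrow>
       norm (integral (cbox x (x + h *\<^sub>R One)) k /\<^sub>R h ^ DIM(real) - k x) < e"
    using integrable_ccontinuous_explicit[of k] i1 by metis
  obtain N2 where N2: "negligible N2"
    "\<And>x e. \<lbrakk>x \<notin> N2; 0 < e\<rbrakk> \<Longrightarrow> \<exists>d>0. \<forall>h. 0 < h \<and> h < d \<longrightarrow>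
       norm (integral (cbox x (x + h *\<^sub>R One)) (\<lambda>x. k (- x)) /\<^sub>R h ^ DIM(real) - k (- x)) < e"
    using integrable_ccontinuous_explicit[of "\<lambda>x. k (- x)"] i2 by metis
  have der: "F differentiable (at x)" if x: "x \<notin> N1" "- x \<notin> N2" for x
  proof -
    have "((\<lambda>h. (F (x + h) - F x) / h) \<longlongrightarrow> k x) (at 0)"
      unfolding LIM_eq
    proof (intro allI impI)
      fix e :: real assume e: "0 < e"
      obtain d1 where d1: "d1 > 0" "\<And>h. 0 < h \<Longrightarrow> h < d1 \<Longrightarrow> 
         norm (integral (cbox x (x + h *\<^sub>R One)) k /\<^sub>R h ^ DIM(real) - k x) < e"
        using N1(2)[OF x(1) e] by blast
      obtain d2 where d2: "d2 > 0" "\<And>h. 0 < h \<Longrightarrow> h < d2 \<Longrightarrow> 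
         norm (integral (cbox (-x) (-x + h *\<^sub>R One)) (\<lambda>x. k (- x)) /\<^sub>R h ^ DIM(real) - k (- (- x))) < e"
        using N2(2)[OF x(2) e] by blast
      have "norm ((F (x + h) - F x) / h - k x) < e" if h: "h \<noteq> 0" "norm (h - 0) < min d1 d2" for h
      proof (cases "h > 0")
        case True
        then have "integral (cbox x (x + h *\<^sub>R One)) k = F (x + h) - F x"
          using kint[of x "x + h"] by (simp add: integral_unique)
        then show ?thesis using d1(2)[of h] h True by (simp add: divide_inverse mult.commute)
      next
        case False
        then have "integral (cbox (-x) (-x + (-h) *\<^sub>R One)) (\<lambda>x. k (- x)) = F x - F (x + h)"
          using integral_unique[OF kint2[of "-x" "-x + (-h)"]] h by (simp add: add.commute)
        moreover have "(F (x + h) - F x) / h = (F x - F (x + h)) /\<^sub>R (- h)"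
          using h by (simp add: field_simps)
        ultimately show ?thesis using d2(2)[of "-h"] h False by simp
      qed
      then show "\<exists>s>0. \<forall>h. h \<noteq> 0 \<and> norm (h - 0) < s \<longrightarrow> norm ((F (x + h) - F x) / h - k x) < e"
        using d1(1) d2(1) by (intro exI[of _ "min d1 d2"]) auto
    qed
    then have "(F has_field_derivative k x) (at x)" by (simp add: DERIV_def)
    then show ?thesis using field_differentiable_def field_differentiable_imp_differentiable by blast
  qed
  have "f differentiable (at x)" if "x \<notin> N1 \<union> uminus ` N2" for x
  proof -
    have "- x \<notin> N2" using that by (metis UnCI image_eqI minus_minus)
    then have "F differentiable (at x)" using der that by auto
    then have "(\<lambda>x. F x - (C + 1) * x) differentiable (at x)" by (intro derivative_intros)
    then show ?thesis by (simp add: F_def)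
  qed
  moreover have "negligible (uminus ` N2)"
    by (rule negligible_differentiable_image_negligible)
      (auto simp: N2 intro!: derivative_intros)
  then have "N1 \<union> uminus ` N2 \<in> null_sets lebesgue"
    using N1 by (simp add: negligible_iff_null_sets[symmetric] negligible_Un)
  ultimately have "AE x in lebesgue. f differentiable (at x)"
    by (intro AE_I'[of "N1 \<union> uminus ` N2"]) auto
  then show ?thesis by (simp add: AE_completion_iff)
qed

section \<open>Rademacher's theorem\<close>

text \<open>A limit along one sequence is Borel measurable for every continuous \<open>f\<close>,
  and it agrees with the two-sided limit wherever that exists.\<close>

definition dir_deriv :: "('a::euclidean_space \<Rightarrow> real) \<Rightarrow> 'a \<Rightarrow> 'a \<Rightarrow> real" where
  "dir_deriv f e x = lim (\<lambda>n. (f (x + (1 / real (Suc n)) *\<^sub>R e) - f x) / (1 / real (Suc n)))"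

section \<open>Translation invariance of Lebesgue measure\<close>

lemma nn_integral_lborel_translate:
  fixes f :: "'a::euclidean_space \<Rightarrow> ennreal"
  assumes "f \<in> borel_measurable borel"
  shows "(\<integral>\<^sup>+x. f (x + c) \<partial>lborel) = (\<integral>\<^sup>+x. f x \<partial>lborel)"
proof -
  have "(\<integral>\<^sup>+x. f x \<partial>lborel) = (\<integral>\<^sup>+x. f x \<partial>distr lborel borel ((+) c))"
    by (simp add: lborel_distr_plus)
  also have "\<dots> = (\<integral>\<^sup>+x. f (x + c) \<partial>lborel)"
    using assms by (subst nn_integral_distr) (auto simp: add.commute)
  finally show ?thesis ..
qed

lemma integral_lborel_translate:
  fixes f :: "'a::euclidean_space \<Rightarrow> real"
  assumes "f \<in> borel_measurable borel"
  shows "(\<integral>x. f (x + c) \<partial>lborel) = (\<integral>x. f x \<partial>lborel)"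
proof -
  have "(\<integral>x. f x \<partial>lborel) = (\<integral>x. f x \<partial>distr lborel borel ((+) c))"
    by (simp add: lborel_distr_plus)
  also have "\<dots> = (\<integral>x. f (x + c) \<partial>lborel)"
    using assms by (subst integral_distr) (auto simp: add.commute)
  finally show ?thesis ..
qed

lemma AE_lborel_translate:
  assumes "AE x in lborel. P (x :: 'a::euclidean_space)"
  shows "AE x in lborel. P (x + c)"
proof -
  have "AE x in distr lborel borel ((+) c). P x" using assms by (subst lborel_distr_plus)
  then have "AE x in lborel. P (c + x)" by (rule AE_distrD[rotated]) simp
  then show ?thesis by (simp add: add.commute)
qed

section \<open>Directional derivatives almost everywhere\<close>

lemma lim_one_over_Suc: "(\<lambda>n. 1 / real (Suc n)) \<longlonglongrightarrow> 0"
  using LIMSEQ_inverse_real_of_nat by (simp add: inverse_eq_divide)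

lemma filterlim_one_over_Suc: "filterlim (\<lambda>n. 1 / real (Suc n)) (at 0) sequentially"
  using lim_one_over_Suc by (auto simp: filterlim_at)

lemma dir_deriv_eqI:
  assumes "((\<lambda>t. (f (x + t *\<^sub>R e) - f x) / t) \<longlongrightarrow> l) (at 0)"
  shows "dir_deriv f e x = l"
  unfolding dir_deriv_def
  by (rule limI) (rule filterlim_compose[OF assms filterlim_one_over_Suc])

text \<open>On every line parallel to \<open>e\<close> the one-dimensional theorem makes the bad set
  null; Fubini and translation invariance then make it null in the whole space.\<close>

lemma Lipschitz_AE_dir_deriv:
  fixes f :: "'a::euclidean_space \<Rightarrow> real"
  assumes f: "C-lipschitz_on UNIV f"
  shows "AE x in lborel. ((\<lambda>t. (f (x + t *\<^sub>R e) - f x) / t) \<longlongrightarrow> dir_deriv f e x) (at 0)"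
proof -
  define q where "q x t = (f (x + t *\<^sub>R e) - f x) / t" for x t
  have contf: "continuous_on UNIV f" using lipschitz_on_continuous_on[OF f] .
  have contf': "continuous_on A (\<lambda>x. f (g x))" if "continuous_on A g" for A :: "'a set" and g
    using continuous_on_compose2[OF contf that] by auto
  have contq: "continuous_on UNIV (\<lambda>x. q x t)" for t
    unfolding q_def divide_inverse by (intro continuous_intros contf')
  \<comment> \<open>A Cauchy condition for the difference quotients. For fixed \<open>s\<close> and
    \<open>t\<close> it is closed in \<open>x\<close>, so \<open>K n m\<close> is closed although
    \<open>s\<close> and \<open>t\<close> range over an uncountable set. This makes \<open>Q\<close>
    Borel, as Fubini requires.\<close>
  define K where "K n m = {x. \<forall>s t. s \<noteq> 0 \<and> t \<noteq> 0 \<and> \<bar>s\<bar> < 1 / real (Suc m) \<and> \<bar>t\<bar> < 1 / real (Suc m) \<longrightarrow>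
     \<bar>q x s - q x t\<bar> \<le> 1 / real (Suc n)}" for n m
  have K_closed: "closed (K n m)" for n m
    unfolding K_def by (intro closed_Collect_all closed_Collect_imp closed_Collect_le open_Collect_const continuous_intros contq)
  define Q where "Q = (\<Inter>n. \<Union>m. K n m)"
  have Q_meas [measurable]: "Q \<in> sets borel" 
    unfolding Q_def using K_closed by (intro sets.countable_INT sets.countable_UN) auto
  have Q_iff: "x \<in> Q \<longleftrightarrow> (\<exists>l. (q x \<longlongrightarrow> l) (at 0))" for x
  proof
    assume "\<exists>l. (q x \<longlongrightarrow> l) (at 0)"
    then obtain l where l: "(q x \<longlongrightarrow> l) (at 0)" by blast
    show "x \<in> Q" unfolding Q_def
    proof safe
      fix n
      have "1 / (2 * real (Suc n)) > 0" by simp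
      then obtain d where d: "d > 0" "\<And>t. t \<noteq> 0 \<Longrightarrow> \<bar>t\<bar> < d \<Longrightarrow> \<bar>q x t - l\<bar> < 1 / (2 * real (Suc n))"
        using LIM_D[OF l] by (metis diff_zero real_norm_def)
      obtain m where m: "1 / real (Suc m) < d"
        using d(1) reals_Archimedean[of d] by (auto simp: inverse_eq_divide)
      have "x \<in> K n m" unfolding K_def
      proof safe
        fix s t :: real assume st: "s \<noteq> 0" "t \<noteq> 0" "\<bar>s\<bar> < 1 / real (Suc m)" "\<bar>t\<bar> < 1 / real (Suc m)"
        have "\<bar>q x s - l\<bar> < 1 / (2 * real (Suc n))" "\<bar>q x t - l\<bar> < 1 / (2 * real (Suc n))"
          using st m d(2)[of s] d(2)[of t] by linarith+
        then have "\<bar>q x s - q x t\<bar> \<le> 1 / (2 * real (Suc n)) + 1 / (2 * real (Suc n))" by linarith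
        then show "\<bar>q x s - q x t\<bar> \<le> 1 / real (Suc n)" by (simp add: field_simps)
      qed
      then show "x \<in> (\<Union>m. K n m)" by blast
    qed
  next
    assume x: "x \<in> Q"
    have Qx: "\<exists>m. \<forall>s t. s \<noteq> 0 \<and> t \<noteq> 0 \<and> \<bar>s\<bar> < 1 / real (Suc m) \<and> \<bar>t\<bar> < 1 / real (Suc m) \<longrightarrow> \<bar>q x s - q x t\<bar> < \<epsilon>"
      if "\<epsilon> > 0" for \<epsilon>
    proof -
      obtain n where "inverse (real (Suc n)) < \<epsilon>"
        using reals_Archimedean[OF \<open>\<epsilon> > 0\<close>] by blast
      then have n: "1 / real (Suc n) < \<epsilon>" by (simp only: inverse_eq_divide)
      obtain m where "x \<in> K n m" using x unfolding Q_def by blast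
      with n show ?thesis unfolding K_def by (intro exI[of _ m]) force
    qed
    define z where "z n = q x (1 / real (Suc n))" for n
    have "Cauchy z"
    proof (rule metric_CauchyI)
      fix \<epsilon> :: real assume "\<epsilon> > 0"
      then obtain m where m: "\<And>s t. s \<noteq> 0 \<Longrightarrow> t \<noteq> 0 \<Longrightarrow> \<bar>s\<bar> < 1 / real (Suc m) \<Longrightarrow> \<bar>t\<bar> < 1 / real (Suc m) \<Longrightarrow> \<bar>q x s - q x t\<bar> < \<epsilon>"
        using Qx by metis
      have "dist (z i) (z j) < \<epsilon>" if "i \<ge> Suc m" "j \<ge> Suc m" for i j
        unfolding z_def dist_real_def using that by (intro m) (auto simp: field_simps)
      then show "\<exists>M. \<forall>m\<ge>M. \<forall>n\<ge>M. dist (z m) (z n) < \<epsilon>" by blast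
    qed
    then obtain l where l: "z \<longlonglongrightarrow> l" using real_Cauchy_convergent convergentD by blast
    have "(q x \<longlongrightarrow> l) (at 0)"
    proof (rule LIM_I)
      fix \<epsilon> :: real assume \<epsilon>: "\<epsilon> > 0"
      then obtain m where m: "\<And>s t. s \<noteq> 0 \<Longrightarrow> t \<noteq> 0 \<Longrightarrow> \<bar>s\<bar> < 1 / real (Suc m) \<Longrightarrow> \<bar>t\<bar> < 1 / real (Suc m) \<Longrightarrow> \<bar>q x s - q x t\<bar> < \<epsilon> / 2"
        using Qx[of "\<epsilon> / 2"] by (metis half_gt_zero)
      have "\<bar>q x s - l\<bar> \<le> \<epsilon> / 2" if s: "s \<noteq> 0" "\<bar>s\<bar> < 1 / real (Suc m)" for s
      proof (rule LIMSEQ_le_const2)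
        show "(\<lambda>n. \<bar>q x s - z n\<bar>) \<longlonglongrightarrow> \<bar>q x s - l\<bar>" by (intro tendsto_intros l)
        have "\<bar>q x s - z n\<bar> \<le> \<epsilon> / 2" if "n \<ge> Suc m" for n
          unfolding z_def using that s by (intro less_imp_le m) (auto simp: field_simps)
        then show "\<exists>N. \<forall>n\<ge>N. \<bar>q x s - z n\<bar> \<le> \<epsilon> / 2" by blast
      qed
      then show "\<exists>s>0. \<forall>t. t \<noteq> 0 \<and> norm (t - 0) < s \<longrightarrow> norm (q x t - l) < \<epsilon>"
        using \<epsilon> by (intro exI[of _ "1 / real (Suc m)"]) force
    qed
    then show "\<exists>l. (q x \<longlongrightarrow> l) (at 0)" by blast
  qed
  have line: "AE t in lborel. x + t *\<^sub>R e \<in> Q" for x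
  proof -
    have "(C * norm e)-lipschitz_on UNIV (\<lambda>t. f (x + t *\<^sub>R e))"
    proof (rule lipschitz_onI)
      fix s t :: real
      have "dist (f (x + s *\<^sub>R e)) (f (x + t *\<^sub>R e)) \<le> C * dist (x + s *\<^sub>R e) (x + t *\<^sub>R e)"
        by (rule lipschitz_onD[OF f]) auto
      also have "dist (x + s *\<^sub>R e) (x + t *\<^sub>R e) = norm e * dist s t"
        by (simp add: dist_norm scaleR_diff_left[symmetric] mult.commute)
      finally show "dist (f (x + s *\<^sub>R e)) (f (x + t *\<^sub>R e)) \<le> C * norm e * dist s t"
        by (simp add: mult.assoc)
    qed (use lipschitz_on_nonneg[OF f] in auto)
    from Lipschitz_real_AE_differentiable[OF this]
    show ?thesis
    proof eventually_elim
      case (elim t)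
      then obtain l where "((\<lambda>t. f (x + t *\<^sub>R e)) has_field_derivative l) (at t)"
        using real_differentiable_def by blast
      then have "((\<lambda>h. (f (x + (t + h) *\<^sub>R e) - f (x + t *\<^sub>R e)) / h) \<longlongrightarrow> l) (at 0)"
        by (simp add: DERIV_def)
      then have "(q (x + t *\<^sub>R e) \<longlongrightarrow> l) (at 0)"
        by (simp add: q_def[abs_def] scaleR_add_left add.assoc)
      then show ?case using Q_iff by blast
    qed
  qed
  \<comment> \<open>All translates of \<open>- Q\<close> along \<open>e\<close> have the same
    measure, so that measure equals its average over a parameter interval of length 1. Exchanging
    the integrals leaves, for each \<open>x\<close>, the bad parameters on a line.\<close>
  have "emeasure lborel (- Q) = (\<integral>\<^sup>+t. indicator {0..1::real} t * emeasure lborel (- Q) \<partial>lborel)"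
    by (simp add: nn_integral_multc)
  also have "\<dots> = (\<integral>\<^sup>+t. (\<integral>\<^sup>+x. indicator {0..1} t * indicator (- Q) (x + t *\<^sub>R e) \<partial>lborel) \<partial>lborel)"
  proof (rule nn_integral_cong)
    fix t :: real
    have "(\<integral>\<^sup>+x. indicator {0..1} t * indicator (- Q) (x + t *\<^sub>R e) \<partial>lborel) = 
        indicator {0..1} t * (\<integral>\<^sup>+x. indicator (- Q) (x + t *\<^sub>R e) \<partial>lborel)"
      by (rule nn_integral_cmult) measurable
    also have "(\<integral>\<^sup>+x. indicator (- Q) (x + t *\<^sub>R e) \<partial>lborel) = emeasure lborel (- Q)"
      by (subst nn_integral_lborel_translate) auto
    finally show "indicator {0..1::real} t * emeasure lborel (- Q) = (\<integral>\<^sup>+x. indicator {0..1} t * indicator (- Q) (x + t *\<^sub>R e) \<partial>lborel)" ..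
  qed
  also have "\<dots> = (\<integral>\<^sup>+x. (\<integral>\<^sup>+t. indicator {0..1} t * indicator (- Q) (x + t *\<^sub>R e) \<partial>lborel) \<partial>lborel)"
    by (rule lborel_pair.Fubini') measurable
  also have "\<dots> = (\<integral>\<^sup>+(x::'a). 0 \<partial>lborel)"
  proof (rule nn_integral_cong)
    fix x
    have "AE t in lborel. indicator {0..1} t * indicator (- Q) (x + t *\<^sub>R e) = (0::ennreal)"
      using line[of x] by eventually_elim simp
    then show "(\<integral>\<^sup>+t. indicator {0..1} t * indicator (- Q) (x + t *\<^sub>R e) \<partial>lborel) = 0"
      using nn_integral_cong_AE by fastforce
  qed
  finally have "emeasure lborel (- Q) = 0" by simp
  then have "- Q \<in> null_sets lborel" by (auto simp: null_sets_def)
  then have "AE x in lborel. x \<in> Q" by (rule AE_I') auto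
  then show ?thesis
  proof eventually_elim
    case (elim x)
    then obtain l where "(q x \<longlongrightarrow> l) (at 0)" using Q_iff by blast
    then show ?case using dir_deriv_eqI[of f x e l] by (simp add: q_def[abs_def])
  qed
qed

lemma dir_deriv_measurable [measurable]:
  assumes "continuous_on UNIV (f :: 'a::euclidean_space \<Rightarrow> real)"
  shows "dir_deriv f e \<in> borel_measurable borel"
proof -
  have [measurable]: "f \<in> borel_measurable borel" using assms by (rule borel_measurable_continuous_onI)
  show ?thesis unfolding dir_deriv_def[abs_def] by measurable
qed

text \<open>Almost everywhere \<open>g\<close> is the limit of its means over shrinking cubes, and
  all these means vanish.\<close>

lemma AE_zero_if_integral_boxes_zero:
  fixes g :: "'a::euclidean_space \<Rightarrow> real"
  assumes int: "\<And>a b. integrable lborel (\<lambda>x. indicator (cbox a b) x * g x)"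
    and zero: "\<And>a b. (\<integral>x. indicator (cbox a b) x * g x \<partial>lborel) = 0"
  shows "AE x in lborel. g x = 0"
proof -
  have si: "set_integrable lborel (cbox a b) g" for a b
    using int by (simp add: set_integrable_def)
  have "integral (cbox a b) g = 0" for a b
    using set_borel_integral_eq_integral(2)[OF si, of a b] zero[of a b]
    by (simp add: set_lebesgue_integral_def)
  note z = this
  have "g integrable_on cbox a b" for a b
    using set_borel_integral_eq_integral(1)[OF si] .
  then obtain N where N: "negligible N" 
       "\<And>x e. \<lbrakk>x \<notin> N; 0 < e\<rbrakk> \<Longrightarrow>
               \<exists>d>0. \<forall>h. 0 < h \<and> h < d \<longrightarrow>
                         norm(integral (cbox x (x + h *\<^sub>R One)) g /\<^sub>R h ^ DIM('a) - g x) < e"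
    using integrable_ccontinuous_explicit[of g] by metis
  have "g x = 0" if x: "x \<notin> N" for x
  proof (rule ccontr)
    assume "g x \<noteq> 0"
    then obtain d :: real where d: "d > 0" "\<forall>h>0. \<not> h < d"
      using N(2)[OF x, of "\<bar>g x\<bar>"] by (auto simp: z)
    then show False using d(2)[rule_format, of "d / 2"] by auto
  qed
  then have "AE x in lebesgue. g x = 0"
    using N(1) by (intro AE_I'[of N]) (auto simp: negligible_iff_null_sets)
  then show ?thesis by (simp add: AE_completion_iff)
qed

lemma integrable_lborel_translate:
  fixes f :: "'a::euclidean_space \<Rightarrow> real"
  assumes "integrable lborel f"
  shows "integrable lborel (\<lambda>x. f (x + c))"
proof -
  have "integrable (distr lborel borel ((+) c)) f" using assms by (subst lborel_distr_plus)
  then have "integrable lborel (\<lambda>x. f (c + x))" by (rule integrable_distr[rotated]) simp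
  then show ?thesis by (simp add: add.commute)
qed

lemma Lipschitz_quotient_bound:
  fixes f :: "'a::euclidean_space \<Rightarrow> real"
  assumes f: "C-lipschitz_on UNIV f"
  shows "\<bar>(f (x + t *\<^sub>R e) - f x) / t\<bar> \<le> C * norm e"
proof (cases "t = 0")
  case False
  have "\<bar>f (x + t *\<^sub>R e) - f x\<bar> \<le> C * (\<bar>t\<bar> * norm e)"
    using lipschitz_onD[OF f, of "x + t *\<^sub>R e" x] by (simp add: dist_norm)
  then show ?thesis using False by (simp add: field_simps)
qed (use lipschitz_on_nonneg[OF f] in auto)

text \<open>The two-sided limit is assumed because \<open>c\<close> may be negative and because
  rescaling leaves the increments sampled by \<open>dir_deriv\<close>.\<close>

lemma dir_deriv_scale:
  fixes f :: "'a::euclidean_space \<Rightarrow> real"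
  assumes "((\<lambda>t. (f (x + t *\<^sub>R e) - f x) / t) \<longlongrightarrow> dir_deriv f e x) (at 0)"
  shows "dir_deriv f (c *\<^sub>R e) x = c * dir_deriv f e x"
proof (cases "c = 0")
  case True
  then show ?thesis by (auto intro!: dir_deriv_eqI)
next
  case False
  have "((\<lambda>t. (f (x + (c * t) *\<^sub>R e) - f x) / (c * t)) \<longlongrightarrow> dir_deriv f e x) (at 0)"
  proof (rule filterlim_compose[OF assms])
    have "((\<lambda>t. c * t) \<longlongrightarrow> c * 0) (at 0)" by (intro tendsto_intros)
    then show "filterlim ((*) c) (at 0) (at 0)"
      using False by (auto simp: filterlim_at eventually_at intro!: exI[of _ 1])
  qed
  then have "((\<lambda>t. c * ((f (x + (c * t) *\<^sub>R e) - f x) / (c * t))) \<longlongrightarrow> c * dir_deriv f e x) (at 0)"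
    by (intro tendsto_intros)
  then have "((\<lambda>t. (f (x + t *\<^sub>R (c *\<^sub>R e)) - f x) / t) \<longlongrightarrow> c * dir_deriv f e x) (at 0)"
    using False by (simp add: mult.commute)
  then show ?thesis by (rule dir_deriv_eqI)
qed

lemma tendsto_indicator_off_frontier:
  fixes A :: "'a::topological_space set"
  assumes y: "y \<notin> frontier A" and X: "X \<longlonglongrightarrow> y"
  shows "(\<lambda>n. indicator A (X n) :: real) \<longlonglongrightarrow> indicator A y"
proof -
  have "eventually (\<lambda>n. indicator A (X n) = (indicator A y :: real)) sequentially"
  proof (cases "y \<in> A")
    case True
    then have "y \<in> interior A" using y closure_subset by (auto simp: frontier_def)
    with X have "eventually (\<lambda>n. X n \<in> interior A) sequentially"
      by (intro topological_tendstoD) auto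
    then show ?thesis
      by eventually_elim (use True interior_subset in \<open>auto simp: indicator_def\<close>)
  next
    case False
    then have "y \<in> - closure A" using y interior_subset by (auto simp: frontier_def)
    with X have "eventually (\<lambda>n. X n \<in> - closure A) sequentially"
      by (intro topological_tendstoD) auto
    then show ?thesis
      by eventually_elim (use False closure_subset in \<open>auto simp: indicator_def\<close>)
  qed
  then show ?thesis by (rule tendsto_eventually)
qed

text \<open>The indicator is shifted because \<open>f (x + s e + s e') - f x\<close> telescopes through \<open>f (x + s e)\<close>:
  the increment along \<open>e'\<close> is taken at \<open>x + s e\<close>, and translating back moves the box.\<close>

lemma dir_deriv_box_limit:
  fixes f :: "'a::euclidean_space \<Rightarrow> real"
  assumes f: "C-lipschitz_on UNIV f"
  defines "s \<equiv> \<lambda>n. 1 / real (Suc n)"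
  shows "integrable lborel (\<lambda>x. indicator (cbox a b) x * dir_deriv f e x)"
    and "(\<lambda>n. \<integral>x. indicator (cbox a b) (x - s n *\<^sub>R e') * ((f (x + s n *\<^sub>R e) - f x) / s n) \<partial>lborel)
      \<longlonglongrightarrow> (\<integral>x. indicator (cbox a b) x * dir_deriv f e x \<partial>lborel)"
    and "integrable lborel (\<lambda>x. indicator (cbox a b) (x - s n *\<^sub>R e') * ((f (x + s n *\<^sub>R e) - f x) / s n))"
proof -
  have contf: "continuous_on UNIV f" using lipschitz_on_continuous_on[OF f] .
  then have [measurable]: "f \<in> borel_measurable borel" by (rule borel_measurable_continuous_onI)
  note dir_deriv_measurable[OF contf, measurable]
  obtain R0 where R0: "\<And>x. x \<in> cbox a b \<Longrightarrow> norm x \<le> R0"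
    using bounded_cbox[of a b] by (auto simp: bounded_iff)
  \<comment> \<open>The shifts \<open>s n\<close> are at most 1, so every shifted box lies in one
    ball; the Lipschitz bound on that ball dominates all the integrands.\<close>
  define R where "R = R0 + norm e'"
  define w where "w x = indicator (cball 0 R) x * (C * norm e)" for x :: 'a
  have C: "C \<ge> 0" using f by (rule lipschitz_on_nonneg)
  have s: "0 < s n" "s n \<le> 1" for n by (auto simp: s_def)
  have bd: "norm (indicator (cbox a b) (x - s n *\<^sub>R e') * ((f (x + s n *\<^sub>R e) - f x) / s n)) \<le> w x" for n x
  proof (cases "x - s n *\<^sub>R e' \<in> cbox a b")
    case True
    have "norm x \<le> norm (x - s n *\<^sub>R e') + norm (s n *\<^sub>R e')" 
      using norm_triangle_ineq[of "x - s n *\<^sub>R e'" "s n *\<^sub>R e'"] by simp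
    also have "\<dots> \<le> R0 + norm e'"
      using R0[OF True] s[of n] mult_right_mono[of "s n" 1 "norm e'"] by (intro add_mono) auto
    finally have "x \<in> cball 0 R" by (simp add: R_def)
    then show ?thesis using Lipschitz_quotient_bound[OF f, of x "s n" e] True by (simp add: w_def)
  qed (use C in \<open>auto simp: w_def\<close>)
  have w: "integrable lborel w" unfolding w_def
    using emeasure_bounded_finite[OF bounded_cball, of "0::'a" R]
    by (intro integrable_mult_left integrable_real_indicator) auto
  \<comment> \<open>The shifted indicators converge off the frontier of the box, which is a null
    set.\<close>
  have fr: "AE x in lborel. x \<notin> frontier (cbox a b)"
  proof -
    have "negligible (frontier (cbox a b))" by (intro negligible_convex_frontier) auto
    then have "AE x in lebesgue. x \<notin> frontier (cbox a b)"
      by (intro AE_I'[of "frontier (cbox a b)"]) (auto simp: negligible_iff_null_sets)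
    then show ?thesis by (simp add: AE_completion_iff)
  qed
  have ae: "AE x in lborel. (\<lambda>n. indicator (cbox a b) (x - s n *\<^sub>R e') * ((f (x + s n *\<^sub>R e) - f x) / s n))
    \<longlonglongrightarrow> indicator (cbox a b) x * dir_deriv f e x"
    using fr Lipschitz_AE_dir_deriv[OF f, of e]
  proof eventually_elim
    case (elim x)
    have "(\<lambda>n. x - s n *\<^sub>R e') \<longlonglongrightarrow> x - 0 *\<^sub>R e'"
      unfolding s_def by (intro tendsto_intros lim_one_over_Suc)
    then have "(\<lambda>n. indicator (cbox a b) (x - s n *\<^sub>R e') :: real) \<longlonglongrightarrow> indicator (cbox a b) x"
      using elim by (intro tendsto_indicator_off_frontier) auto
    moreover have "(\<lambda>n. (f (x + s n *\<^sub>R e) - f x) / s n) \<longlonglongrightarrow> dir_deriv f e x"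
      unfolding s_def using filterlim_compose[OF elim(2) filterlim_one_over_Suc] .
    ultimately show ?case by (intro tendsto_mult)
  qed
  have m: "(\<lambda>x. indicator (cbox a b) (x - s n *\<^sub>R e') * ((f (x + s n *\<^sub>R e) - f x) / s n)) \<in> borel_measurable lborel" for n
    by measurable
  have m': "(\<lambda>x. indicator (cbox a b) x * dir_deriv f e x) \<in> borel_measurable lborel" by measurable
  show "integrable lborel (\<lambda>x. indicator (cbox a b) x * dir_deriv f e x)"
    and "(\<lambda>n. \<integral>x. indicator (cbox a b) (x - s n *\<^sub>R e') * ((f (x + s n *\<^sub>R e) - f x) / s n) \<partial>lborel)
      \<longlonglongrightarrow> (\<integral>x. indicator (cbox a b) x * dir_deriv f e x \<partial>lborel)"
    and "integrable lborel (\<lambda>x. indicator (cbox a b) (x - s n *\<^sub>R e') * ((f (x + s n *\<^sub>R e) - f x) / s n))"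
    using integrable_dominated_convergence[OF m' m w ae] integral_dominated_convergence[OF m' m w ae]
      integrable_dominated_convergence2[OF m' m w ae] bd by auto
qed

text \<open>Existence of directional derivatives at a point does not make them additive in the
  direction. Their integrals over boxes are additive, and these determine a function almost
  everywhere.\<close>

lemma dir_deriv_add_AE:
  fixes f :: "'a::euclidean_space \<Rightarrow> real"
  assumes f: "C-lipschitz_on UNIV f"
  shows "AE x in lborel. dir_deriv f (e + e') x = dir_deriv f e x + dir_deriv f e' x"
proof -
  have contf: "continuous_on UNIV f" using lipschitz_on_continuous_on[OF f] .
  then have [measurable]: "f \<in> borel_measurable borel" by (rule borel_measurable_continuous_onI)
  define s where "s n = 1 / real (Suc n)" for n
  define g where "g x = dir_deriv f (e + e') x - (dir_deriv f e x + dir_deriv f e' x)" for x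
  have sum0: "(\<integral>x. indicator (cbox a b) x * dir_deriv f (e + e') x \<partial>lborel) =
      (\<integral>x. indicator (cbox a b) x * dir_deriv f e x \<partial>lborel) + (\<integral>x. indicator (cbox a b) x * dir_deriv f e' x \<partial>lborel)" for a b
  proof -
    define I where "I z' z n = (\<integral>x. indicator (cbox a b) (x - s n *\<^sub>R z') * ((f (x + s n *\<^sub>R z) - f x) / s n) \<partial>lborel)" for z' z n
    have lim: "I z' z \<longlonglongrightarrow> (\<integral>x. indicator (cbox a b) x * dir_deriv f z x \<partial>lborel)" for z z'
      unfolding I_def s_def by (rule dir_deriv_box_limit(2)[OF f])
    have "I 0 (e + e') n = I 0 e n + I e e' n" for n
    proof -
      have eq: "indicator (cbox a b) x * ((f (x + s n *\<^sub>R (e + e')) - f x) / s n) = 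
         indicator (cbox a b) x * ((f (x + s n *\<^sub>R e) - f x) / s n) + 
         indicator (cbox a b) ((x + s n *\<^sub>R e) - s n *\<^sub>R e) * ((f ((x + s n *\<^sub>R e) + s n *\<^sub>R e') - f (x + s n *\<^sub>R e)) / s n)" for x
        by (simp add: algebra_simps add_divide_distrib diff_divide_distrib)
      let ?h = "\<lambda>x. indicator (cbox a b) (x - s n *\<^sub>R e) * ((f (x + s n *\<^sub>R e') - f x) / s n)"
      have hm: "?h \<in> borel_measurable borel" by measurable
      have hi: "integrable lborel ?h" unfolding s_def by (rule dir_deriv_box_limit(3)[OF f])
      have hi': "integrable lborel (\<lambda>x. ?h (x + s n *\<^sub>R e))"
        using integrable_lborel_translate[OF hi] .
      have i1: "integrable lborel (\<lambda>x. indicator (cbox a b) x * ((f (x + s n *\<^sub>R e) - f x) / s n))"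
        using dir_deriv_box_limit(3)[OF f, of a b n 0 e] by (simp add: s_def)
      have "I 0 (e + e') n = (\<integral>x. indicator (cbox a b) x * ((f (x + s n *\<^sub>R e) - f x) / s n) + ?h (x + s n *\<^sub>R e) \<partial>lborel)"
        unfolding I_def by (simp only: scaleR_zero_right diff_zero eq)
      also have "\<dots> = I 0 e n + (\<integral>x. ?h (x + s n *\<^sub>R e) \<partial>lborel)"
        using Bochner_Integration.integral_add[OF i1 hi'] by (simp add: I_def)
      also have "(\<integral>x. ?h (x + s n *\<^sub>R e) \<partial>lborel) = I e e' n"
        using integral_lborel_translate[OF hm, of "s n *\<^sub>R e"] by (simp only: I_def)
      finally show ?thesis .
    qed
    then have "I 0 (e + e') = (\<lambda>n. I 0 e n + I e e' n)" by auto
    then have "I 0 (e + e') \<longlonglongrightarrow> (\<integral>x. indicator (cbox a b) x * dir_deriv f e x \<partial>lborel) + (\<integral>x. indicator (cbox a b) x * dir_deriv f e' x \<partial>lborel)"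
      using tendsto_add[OF lim[of 0 e] lim[of e e']] by simp
    then show ?thesis using LIMSEQ_unique lim[of 0 "e + e'"] by blast
  qed
  have i: "integrable lborel (\<lambda>x. indicator (cbox a b) x * dir_deriv f z x)" for a b z
    by (rule dir_deriv_box_limit(1)[OF f])
  have "AE x in lborel. g x = 0"
  proof (rule AE_zero_if_integral_boxes_zero)
    show "integrable lborel (\<lambda>x. indicator (cbox a b) x * g x)" for a b
      unfolding g_def distrib_left right_diff_distrib
      by (intro Bochner_Integration.integrable_diff Bochner_Integration.integrable_add i)
    show "(\<integral>x. indicator (cbox a b) x * g x \<partial>lborel) = 0" for a b
      unfolding g_def distrib_left right_diff_distrib
      by (subst Bochner_Integration.integral_diff Bochner_Integration.integral_add; 
          (intro Bochner_Integration.integrable_diff Bochner_Integration.integrable_add i)?)+ (simp add: sum0 i)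
  qed
  then show ?thesis by eventually_elim (simp add: g_def)
qed

text \<open>Additivity is applied one coordinate of \<open>e\<close> at a time, so finitely many
  null sets are discarded; which ones depends on \<open>e\<close>.\<close>

lemma dir_deriv_linear_AE:
  fixes f :: "'a::euclidean_space \<Rightarrow> real"
  assumes f: "C-lipschitz_on UNIV f"
  shows "AE x in lborel. dir_deriv f e x = e \<bullet> (\<Sum>b\<in>Basis. dir_deriv f b x *\<^sub>R b)"
proof -
  have "AE x in lborel. dir_deriv f (\<Sum>b\<in>T. (e \<bullet> b) *\<^sub>R b) x = (\<Sum>b\<in>T. (e \<bullet> b) * dir_deriv f b x)"
    if "finite T" for T
    using that
  proof (induction T)
    case empty
    show ?case by (auto intro!: AE_I2 dir_deriv_eqI)
  next
    case (insert c T)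
    show ?case 
      using insert.IH Lipschitz_AE_dir_deriv[OF f, of c]
        dir_deriv_add_AE[OF f, of "(e \<bullet> c) *\<^sub>R c" "\<Sum>b\<in>T. (e \<bullet> b) *\<^sub>R b"]
    proof eventually_elim
      case (elim x)
      then show ?case using insert.hyps dir_deriv_scale[OF elim(2), of "e \<bullet> c"] by simp
    qed
  qed
  from this[OF finite_Basis] show ?thesis
    by eventually_elim (simp add: euclidean_representation inner_sum_right mult.commute)
qed

text \<open>The exceptional null sets depend on the direction, so only a countable dense set of
  directions can be treated at once. Compactness of the unit sphere and the Lipschitz bound carry
  the expansion from finitely many of these to all directions, uniformly.\<close>

theorem Rademacher:
  fixes f :: "'a::euclidean_space \<Rightarrow> real"
  assumes f: "C-lipschitz_on UNIV f"
  shows "AE x in lborel. GDERIV f x :> (\<Sum>b\<in>Basis. dir_deriv f b x *\<^sub>R b)"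
proof -
  have C: "C \<ge> 0" using f by (rule lipschitz_on_nonneg)
  obtain D :: "'a set" where D: "countable D" "\<And>X. open X \<Longrightarrow> X \<noteq> {} \<Longrightarrow> \<exists>d\<in>D. d \<in> X"
    using countable_dense_setE by metis
  have "AE x in lborel. \<forall>e\<in>D. ((\<lambda>t. (f (x + t *\<^sub>R e) - f x) / t) \<longlongrightarrow> dir_deriv f e x) (at 0) \<and>
      dir_deriv f e x = e \<bullet> (\<Sum>b\<in>Basis. dir_deriv f b x *\<^sub>R b)"
    using Lipschitz_AE_dir_deriv[OF f] dir_deriv_linear_AE[OF f]
    by (intro AE_ball_countable'[OF _ D(1)] AE_conjI) auto
  then show ?thesis
  proof eventually_elim
    case (elim x)
    define G where "G = (\<Sum>b\<in>Basis. dir_deriv f b x *\<^sub>R b)"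
    have lim: "((\<lambda>t. (f (x + t *\<^sub>R e) - f x) / t) \<longlongrightarrow> e \<bullet> G) (at 0)" if "e \<in> D" for e
      using elim that by (auto simp: G_def)
    have main: "\<exists>d>0. \<forall>y. norm (y - x) < d \<longrightarrow> norm (f y - f x - (y - x) \<bullet> G) \<le> \<epsilon> * norm (y - x)"
      if \<epsilon>: "\<epsilon> > 0" for \<epsilon>
    proof -
      \<comment> \<open>Three errors are to be covered: the quotient in the chosen direction
        \<open>e\<close> (weight 1), the change of \<open>f\<close> on moving from direction
        \<open>z\<close> to \<open>e\<close> (weight \<open>C\<close>), and the change of the linear
        part (weight \<open>norm G\<close>).\<close>
      define \<eta> where "\<eta> = \<epsilon> / (1 + C + norm G)"
      have pos: "1 + C + norm G > 0" using C norm_ge_zero[of G] by linarith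
      have \<eta>: "\<eta> > 0" using \<epsilon> pos by (simp add: \<eta>_def)
      have cov: "sphere 0 1 \<subseteq> (\<Union>e\<in>D. ball e \<eta>)"
      proof
        fix z :: 'a
        obtain e where "e \<in> D" "e \<in> ball z \<eta>" using D(2)[of "ball z \<eta>"] \<eta> by auto
        then show "z \<in> (\<Union>e\<in>D. ball e \<eta>)" by (auto simp: dist_commute)
      qed
      obtain E where E: "E \<subseteq> D" "finite E" "sphere 0 1 \<subseteq> (\<Union>e\<in>E. ball e \<eta>)"
        by (rule compactE_image[OF compact_sphere _ cov]) auto
      have "\<exists>d>0. \<forall>t. \<bar>t\<bar> < d \<longrightarrow> \<bar>f (x + t *\<^sub>R e) - f x - t * (e \<bullet> G)\<bar> \<le> \<eta> * \<bar>t\<bar>" if eD: "e \<in> D" for e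
      proof -
        obtain d where d: "d > 0" "\<And>t. t \<noteq> 0 \<Longrightarrow> \<bar>t\<bar> < d \<Longrightarrow> \<bar>(f (x + t *\<^sub>R e) - f x) / t - e \<bullet> G\<bar> < \<eta>"
          using LIM_D[OF lim[OF eD] \<eta>] by auto
        have "\<bar>f (x + t *\<^sub>R e) - f x - t * (e \<bullet> G)\<bar> \<le> \<eta> * \<bar>t\<bar>" if "\<bar>t\<bar> < d" for t
        proof (cases "t = 0")
          case False
          have "f (x + t *\<^sub>R e) - f x - t * (e \<bullet> G) = ((f (x + t *\<^sub>R e) - f x) / t - e \<bullet> G) * t"
            by (subst left_diff_distrib) (use False in \<open>simp add: mult.commute\<close>)
          then have "\<bar>f (x + t *\<^sub>R e) - f x - t * (e \<bullet> G)\<bar> = \<bar>(f (x + t *\<^sub>R e) - f x) / t - e \<bullet> G\<bar> * \<bar>t\<bar>"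
            by (simp only: abs_mult)
          also have "\<dots> \<le> \<eta> * \<bar>t\<bar>" using d(2)[OF False that] by (intro mult_right_mono) auto
          finally show ?thesis .
        qed simp
        then show ?thesis using d(1) by blast
      qed
      then obtain d where d: "\<And>e. e \<in> D \<Longrightarrow> d e > 0"
          "\<And>e t. e \<in> D \<Longrightarrow> \<bar>t\<bar> < d e \<Longrightarrow> \<bar>f (x + t *\<^sub>R e) - f x - t * (e \<bullet> G)\<bar> \<le> \<eta> * \<bar>t\<bar>"
        by metis
      define \<delta> where "\<delta> = Min (insert 1 (d ` E))"
      have \<delta>: "\<delta> > 0" "\<And>e. e \<in> E \<Longrightarrow> \<delta> \<le> d e"
        using E(1,2) d(1) by (auto simp: \<delta>_def)
      have "norm (f y - f x - (y - x) \<bullet> G) \<le> \<epsilon> * norm (y - x)" if y: "norm (y - x) < \<delta>" for y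
      proof (cases "y = x")
        case False
        define t where "t = norm (y - x)"
        define z where "z = (y - x) /\<^sub>R t"
        have t: "t > 0" using False by (simp add: t_def)
        have yx: "y = x + t *\<^sub>R z" using t by (simp add: z_def)
        have "norm z = 1" using t by (simp add: z_def t_def)
        then obtain e where e: "e \<in> E" "dist e z < \<eta>" using E(3) by (auto simp: subset_iff)
        have 1: "\<bar>f (x + t *\<^sub>R e) - f x - t * (e \<bullet> G)\<bar> \<le> \<eta> * t"
          using d(2)[of e t] e(1) E(1) \<delta>(2)[of e] t y by (auto simp: t_def)
        have "\<bar>f y - f (x + t *\<^sub>R e)\<bar> \<le> C * dist y (x + t *\<^sub>R e)"
          using lipschitz_onD[OF f, of y "x + t *\<^sub>R e"] by (simp add: dist_norm)
        also have "dist y (x + t *\<^sub>R e) = t * dist e z"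
          using t by (simp add: yx dist_norm scaleR_diff_right[symmetric] norm_minus_commute)
        also have "C * (t * dist e z) \<le> C * (t * \<eta>)" using e(2) t C by (intro mult_left_mono) auto
        finally have 2: "\<bar>f y - f (x + t *\<^sub>R e)\<bar> \<le> C * (t * \<eta>)" .
        have "\<bar>(e - z) \<bullet> G\<bar> \<le> norm (e - z) * norm G" by (rule Cauchy_Schwarz_ineq2)
        also have "\<dots> \<le> \<eta> * norm G" using e(2) by (intro mult_right_mono) (auto simp: dist_norm)
        finally have "t * \<bar>(e - z) \<bullet> G\<bar> \<le> t * (\<eta> * norm G)" using t by (intro mult_left_mono) auto
        then have 3: "\<bar>t * (e \<bullet> G) - (y - x) \<bullet> G\<bar> \<le> t * (\<eta> * norm G)"
          using t by (simp add: yx inner_diff_left abs_mult right_diff_distrib[symmetric])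
        have "\<bar>f y - f x - (y - x) \<bullet> G\<bar> \<le> \<eta> * t + C * (t * \<eta>) + t * (\<eta> * norm G)"
          using 1 2 3 by linarith
        also have "\<dots> = (\<eta> * (1 + C + norm G)) * t" by (simp add: algebra_simps)
        also have "\<eta> * (1 + C + norm G) = \<epsilon>" using pos by (simp add: \<eta>_def)
        finally show ?thesis by (simp add: t_def)
      qed simp
      then show ?thesis using \<delta>(1) by blast
    qed
    have "bounded_linear (\<lambda>h. h \<bullet> G)" by (rule bounded_linear_inner_left)
    then have "(f has_derivative (\<lambda>h. h \<bullet> G)) (at x)"
      unfolding has_derivative_at_alt using main by auto
    then show ?case by (simp add: gderiv_def G_def)
  qed
qed

section \<open>Gradients of Lipschitz functions\<close>

text \<open>McShane's extension: the lower envelope of the cones of slope \<open>K\<close> with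
  vertices on the graph. It keeps the constant, so gradient bounds are not lost.\<close>

lemma Lipschitz_real_extension:
  fixes f :: "'a::metric_space \<Rightarrow> real"
  assumes f: "K-lipschitz_on S f"
  obtains h where "K-lipschitz_on UNIV h" "\<And>x. x \<in> S \<Longrightarrow> h x = f x"
proof (cases "S = {}")
  case True
  then show ?thesis using that[of "\<lambda>_. 0"] lipschitz_on_nonneg[OF f]
    by (auto intro: lipschitz_on_mono[OF lipschitz_on_constant])
next
  case False
  have K: "K \<ge> 0" using f by (rule lipschitz_on_nonneg)
  define h where "h x = (INF y\<in>S. f y + K * dist x y)" for x
  have low: "f z - K * dist x z \<le> f y + K * dist x y" if "z \<in> S" "y \<in> S" for x y z
  proof -
    have "f z - f y \<le> K * dist z y" using lipschitz_onD[OF f that] by (simp add: dist_real_def)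
    also have "\<dots> \<le> K * (dist x z + dist x y)"
      using K dist_triangle3[of z y x] by (intro mult_left_mono) auto
    finally show ?thesis by (simp add: algebra_simps)
  qed
  obtain z0 where z0: "z0 \<in> S" using False by blast
  have bdd: "bdd_below ((\<lambda>y. f y + K * dist x y) ` S)" for x
    using low[OF z0] by (intro bdd_belowI2[of _ "f z0 - K * dist x z0"])
  have half: "h x \<le> h y + K * dist x y" for x y
  proof -
    have "h x - K * dist x y \<le> h y" unfolding h_def[of y]
    proof (rule cINF_greatest[OF False])
      fix z assume z: "z \<in> S"
      have "h x \<le> f z + K * dist x z" unfolding h_def by (rule cINF_lower[OF bdd z])
      also have "\<dots> \<le> f z + K * (dist x y + dist y z)"
        using K dist_triangle[of x z y] by (intro add_left_mono mult_left_mono) auto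
      finally show "h x - K * dist x y \<le> f z + K * dist y z" by (simp add: algebra_simps)
    qed
    then show ?thesis by simp
  qed
  show ?thesis
  proof
    show "K-lipschitz_on UNIV h"
    proof (rule lipschitz_onI)
      fix x y show "dist (h x) (h y) \<le> K * dist x y"
        using half[of x y] half[of y x] by (simp add: dist_real_def dist_commute abs_le_iff)
    qed (rule K)
    fix x assume x: "x \<in> S"
    show "h x = f x"
    proof (rule antisym)
      show "h x \<le> f x" using cINF_lower[OF bdd[of x] x] by (simp add: h_def)
      show "f x \<le> h x" unfolding h_def
        by (rule cINF_greatest[OF False]) (use low[OF x, of _ x] in auto)
    qed
  qed
qed

section \<open>Pointwise gradients\<close>

lemma GDERIV_unique:
  assumes "GDERIV f x :> D" "GDERIV f x :> E"
  shows "D = E"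
proof -
  have "(\<lambda>h. h \<bullet> D) = (\<lambda>h. h \<bullet> E)"
    using assms unfolding gderiv_def by (rule has_derivative_unique)
  then have "(D - E) \<bullet> D = (D - E) \<bullet> E" by (rule fun_cong)
  then have "(D - E) \<bullet> (D - E) = 0" by (simp add: inner_diff_right)
  then show ?thesis by simp
qed

lemma grad_eqI:
  assumes "GDERIV v x :> D"
  shows "grad v x = D"
proof -
  have "(THE D. GDERIV v x :> D) = D"
    using assms by (rule the_equality) (rule GDERIV_unique[OF _ assms])
  then show ?thesis using assms by (metis grad_def)
qed

lemma GDERIV_transform_within_open:
  assumes "GDERIV v x :> D" "open U" "x \<in> U" "\<And>y. y \<in> U \<Longrightarrow> v y = w y"
  shows "GDERIV w x :> D"
  using has_derivative_transform_within_open[of v _ x UNIV U w] assms unfolding gderiv_def by auto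

text \<open>Valid at every point, the default value included, since both functions have the same
  derivative relation at \<open>x\<close>.\<close>

lemma grad_cong_open:
  assumes "open U" "x \<in> U" "\<And>y. y \<in> U \<Longrightarrow> v y = w y"
  shows "grad v x = grad w x"
proof -
  have "GDERIV v x :> D \<longleftrightarrow> GDERIV w x :> D" for D
    using GDERIV_transform_within_open[of v x D U w] GDERIV_transform_within_open[of w x D U v] assms by auto
  then have "gderiv v x = gderiv w x" by (rule ext)
  then show ?thesis by (simp only: grad_def)
qed

lemma grad_translate_add_const:
  fixes v :: "'a::euclidean_space \<Rightarrow> real"
  shows "grad (\<lambda>y. v (y + c) + k) x = grad v (x + c)"
proof -
  have 1: "GDERIV (\<lambda>y. w (y + c) + k) x :> D" if "GDERIV w (x + c) :> D" 
    for w :: "'a \<Rightarrow> real" and c x D k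
  proof -
    have "((\<lambda>y. y + c) has_derivative (\<lambda>h. h)) (at x)" by (auto intro!: derivative_eq_intros)
    then have "((\<lambda>y. w (y + c)) has_derivative (\<lambda>h. h \<bullet> D)) (at x)"
      using that unfolding gderiv_def by (rule has_derivative_compose)
    then have "((\<lambda>y. w (y + c) + k) has_derivative (\<lambda>h. h \<bullet> D + 0)) (at x)"
      by (intro has_derivative_add has_derivative_const)
    then show ?thesis by (simp add: gderiv_def)
  qed
  have "GDERIV (\<lambda>y. v (y + c) + k) x :> D \<longleftrightarrow> GDERIV v (x + c) :> D" for D
    using 1[of v x c D k] 1[of "\<lambda>y. v (y + c) + k" "x + c" "-c" D "-k"] by auto
  then have "gderiv (\<lambda>y. v (y + c) + k) x = gderiv v (x + c)" by (rule ext)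
  then show ?thesis by (simp only: grad_def)
qed

lemma GDERIV_directional:
  fixes w :: "'a::euclidean_space \<Rightarrow> real"
  assumes "GDERIV w x :> D"
  shows "((\<lambda>s. (w (x + s *\<^sub>R e) - w x) / s) \<longlongrightarrow> e \<bullet> D) (at 0)"
proof -
  have "((\<lambda>s. x + s *\<^sub>R e) has_derivative (\<lambda>h. h *\<^sub>R e)) (at 0)"
    by (auto intro!: derivative_eq_intros)
  moreover have "(w has_derivative (\<lambda>h. h \<bullet> D)) (at (x + 0 *\<^sub>R e))"
    using assms by (simp add: gderiv_def)
  ultimately have "((\<lambda>s. w (x + s *\<^sub>R e)) has_derivative (\<lambda>h. (h *\<^sub>R e) \<bullet> D)) (at 0)"
    by (rule has_derivative_compose)
  then have "((\<lambda>s. w (x + s *\<^sub>R e)) has_field_derivative (e \<bullet> D)) (at 0)"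
    unfolding has_field_derivative_def by (rule has_derivative_eq_rhs) (auto simp: mult.commute)
  then show ?thesis by (simp add: DERIV_def)
qed

text \<open>Differentiating along \<open>D\<close> itself gives |D|^2 \<le> s |D|. At a point of
  non-differentiability the default gradient 0 obeys the bound because \<open>s\<close> is
  nonnegative, so the estimate holds everywhere and not just almost everywhere.\<close>

lemma norm_grad_le:
  fixes v :: "'a::euclidean_space \<Rightarrow> real"
  assumes "open U" "x \<in> U" "s \<ge> 0" and v: "\<And>y. y \<in> U \<Longrightarrow> \<bar>v y - v x\<bar> \<le> s * norm (y - x)"
  shows "norm (grad v x) \<le> s"
proof (cases "\<exists>D. GDERIV v x :> D")
  case True
  then obtain D where D: "GDERIV v x :> D" by blast
  obtain r where r: "r > 0" "ball x r \<subseteq> U" using assms openE by blast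
  have "norm D * norm D \<le> s * norm D"
  proof (cases "D = 0")
    case False
    have "\<bar>D \<bullet> D\<bar> \<le> s * norm D"
    proof (rule Lim_norm_ubound[OF _ GDERIV_directional[OF D, of D], unfolded real_norm_def])
      have "\<bar>(v (x + t *\<^sub>R D) - v x) / t\<bar> \<le> s * norm D" if "t \<noteq> 0" "\<bar>t\<bar> < r / norm D" for t
      proof -
        have "\<bar>t\<bar> * norm D < r" using that(2) False by (simp add: field_simps)
        then have "x + t *\<^sub>R D \<in> U" using r by (auto simp: dist_norm)
        then have "\<bar>v (x + t *\<^sub>R D) - v x\<bar> \<le> s * (\<bar>t\<bar> * norm D)"
          using v[of "x + t *\<^sub>R D"] by simp
        then show ?thesis using that(1) by (simp add: field_simps)
      qed
      then show "eventually (\<lambda>t. \<bar>(v (x + t *\<^sub>R D) - v x) / t\<bar> \<le> s * norm D) (at 0)"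
        using r False by (auto simp: eventually_at intro!: exI[of _ "r / norm D"])
    qed auto
    then show ?thesis by (simp add: dot_square_norm power2_eq_square)
  qed simp
  then have "norm D \<le> s" using assms(3) by (cases "D = 0") auto
  then show ?thesis using grad_eqI[OF D] by simp
qed (use assms(3) in \<open>simp add: grad_def\<close>)

lemma Lipschitz_norm_grad_le:
  fixes v :: "'a::euclidean_space \<Rightarrow> real"
  assumes "open \<Omega>" "C-lipschitz_on \<Omega> v" "x \<in> \<Omega>"
  shows "norm (grad v x) \<le> C"
  using assms lipschitz_onD[OF assms(2) _ assms(3)] lipschitz_on_nonneg[OF assms(2)]
  by (intro norm_grad_le[of \<Omega>]) (auto simp: dist_norm)

text \<open>Completeness of Lebesgue measure. It is needed because \<open>grad\<close> is identified
  with a Borel field only almost everywhere.\<close>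

lemma lebesgue_measurable_AE_eq:
  fixes f g :: "'a::euclidean_space \<Rightarrow> 'b::topological_space"
  assumes g: "g \<in> borel_measurable lebesgue" and ae: "AE x in lborel. f x = g x"
  shows "f \<in> borel_measurable lebesgue"
proof (rule measurableI)
  fix A :: "'b set" assume A: "A \<in> sets borel"
  have "g -` A \<inter> space lebesgue \<in> sets lebesgue" using g A by (rule measurable_sets)
  moreover have "AE x in lebesgue. x \<in> g -` A \<inter> space lebesgue \<longleftrightarrow> x \<in> f -` A \<inter> space lebesgue"
    using AE_completion[OF ae] by eventually_elim auto
  ultimately show "f -` A \<inter> space lebesgue \<in> sets lebesgue"
    by (intro completion.in_sets_AE[of _ "f -` A \<inter> space lebesgue"]) auto
qed auto

lemma AE_lebesgue_on_iff:
  fixes \<Omega> :: "'a::euclidean_space set"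
  assumes "open \<Omega>"
  shows "(AE x in lebesgue_on \<Omega>. P x) \<longleftrightarrow> (AE x in lborel. x \<in> \<Omega> \<longrightarrow> P x)"
  using assms by (subst AE_restrict_space_iff) (auto simp: AE_completion_iff)

lemma nn_integral_lebesgue_on:
  fixes \<Omega> :: "'a::euclidean_space set"
  assumes "open \<Omega>"
  shows "(\<integral>\<^sup>+x. f x \<partial>lebesgue_on \<Omega>) = (\<integral>\<^sup>+x. f x * indicator \<Omega> x \<partial>lborel)"
  using assms by (subst nn_integral_restrict_space) (auto simp: nn_integral_completion)

text \<open>The extension to the whole space has the explicit Borel gradient of Rademacher's
  theorem, and on the open set it is also the gradient of \<open>v\<close>. The representative
  \<open>D\<close> matters later, where integrals against \<open>lborel\<close> are
  translated.\<close>

lemma Lipschitz_AE_grad: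
  fixes v :: "'a::euclidean_space \<Rightarrow> real"
  assumes "open \<Omega>" "C-lipschitz_on \<Omega> v"
  obtains D where "D \<in> borel_measurable borel" "AE x in lborel. x \<in> \<Omega> \<longrightarrow> GDERIV v x :> D x"
    "AE x in lborel. x \<in> \<Omega> \<longrightarrow> grad v x = D x"
proof -
  obtain V where V: "C-lipschitz_on UNIV V" "\<And>x. x \<in> \<Omega> \<Longrightarrow> V x = v x"
    using Lipschitz_real_extension[OF assms(2)] by blast
  define D where "D x = (\<Sum>b\<in>Basis. dir_deriv V b x *\<^sub>R b)" for x
  note dir_deriv_measurable[OF lipschitz_on_continuous_on[OF V(1)], measurable]
  have m: "D \<in> borel_measurable borel" unfolding D_def by measurable
  have ae: "AE x in lborel. x \<in> \<Omega> \<longrightarrow> GDERIV v x :> D x"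
    using Rademacher[OF V(1)]
  proof eventually_elim
    case (elim x)
    then show ?case using GDERIV_transform_within_open[of V x _ \<Omega> v] assms(1) V(2) 
      by (auto simp: D_def)
  qed
  then have "AE x in lborel. x \<in> \<Omega> \<longrightarrow> grad v x = D x"
    by eventually_elim (auto intro: grad_eqI)
  then show ?thesis using that m ae by blast
qed

lemma Lipschitz_AE_GDERIV:
  fixes v :: "'a::euclidean_space \<Rightarrow> real"
  assumes "open \<Omega>" "C-lipschitz_on \<Omega> v"
  shows "AE x in lborel. x \<in> \<Omega> \<longrightarrow> GDERIV v x :> grad v x"
proof -
  obtain D where "AE x in lborel. x \<in> \<Omega> \<longrightarrow> GDERIV v x :> D x"
    "AE x in lborel. x \<in> \<Omega> \<longrightarrow> grad v x = D x"
    using Lipschitz_AE_grad[OF assms] by metis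
  then show ?thesis by eventually_elim auto
qed

lemma grad_measurable:
  fixes v :: "'a::euclidean_space \<Rightarrow> real"
  assumes "open \<Omega>" "C-lipschitz_on \<Omega> v"
  shows "grad v \<in> borel_measurable (lebesgue_on \<Omega>)"
proof -
  obtain D where D: "D \<in> borel_measurable borel" "AE x in lborel. x \<in> \<Omega> \<longrightarrow> grad v x = D x"
    using Lipschitz_AE_grad[OF assms] by metis
  have "(\<lambda>x. if x \<in> \<Omega> then grad v x else D x) \<in> borel_measurable lebesgue"
    by (rule lebesgue_measurable_AE_eq[of D]) (use D in \<open>auto intro: measurable_completion elim!: eventually_mono\<close>)
  then have "(\<lambda>x. if x \<in> \<Omega> then grad v x else D x) \<in> borel_measurable (lebesgue_on \<Omega>)"
    by (rule measurable_restrict_space1)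
  then show ?thesis by (rule measurable_cong[THEN iffD1, rotated]) auto
qed

text \<open>A segment from a point of \<open>U\<close> to a point outside meets the frontier, where
  \<open>w\<close> is 0, so only the part up to that crossing contributes. The formula
  \<open>w'\<close> on the closure is kept apart from \<open>w\<close>, which is defined by
  cases.\<close>

lemma Lipschitz_zero_extension:
  fixes w :: "'a::euclidean_space \<Rightarrow> real"
  assumes w: "K-lipschitz_on (closure U) w'" and eq: "\<And>x. x \<in> closure U \<Longrightarrow> w x = w' x"
    and fr: "\<And>x. x \<in> frontier U \<Longrightarrow> w x = 0" and out: "\<And>x. x \<notin> U \<Longrightarrow> w x = 0"
  shows "K-lipschitz_on UNIV w"
proof -
  have K: "K \<ge> 0" using w by (rule lipschitz_on_nonneg)
  have wc: "\<bar>w x - w y\<bar> \<le> K * dist x y" if "x \<in> closure U" "y \<in> closure U" for x y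
    using lipschitz_onD[OF w that] that by (simp add: eq dist_real_def)
  have mixed: "\<bar>w x\<bar> \<le> K * dist x y" if x: "x \<in> U" and y: "y \<notin> U" for x y
  proof -
    obtain z where z: "z \<in> closed_segment x y" "z \<in> frontier U"
      using connected_Int_frontier[of "closed_segment x y" U] x y by auto
    have "\<bar>w x\<bar> \<le> K * dist x z" using wc[of x z] x z(2) fr[OF z(2)] closure_subset
      by (auto simp: frontier_def)
    also have "\<dots> \<le> K * dist x y" using K dist_in_closed_segment[OF z(1)]
      by (intro mult_left_mono) (auto simp: dist_commute)
    finally show ?thesis .
  qed
  show ?thesis
  proof (rule lipschitz_onI)
    fix x y
    show "dist (w x) (w y) \<le> K * dist x y"
      using wc[of x y] mixed[of x y] mixed[of y x] out[of x] out[of y] K closure_subset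
      by (cases "x \<in> U"; cases "y \<in> U") (auto simp: dist_real_def dist_commute)
  qed (rule K)
qed

lemma continuous_AE_zero_imp_zero:
  fixes w :: "'a::euclidean_space \<Rightarrow> real"
  assumes "continuous_on UNIV w" "AE x in lborel. w x = 0"
  shows "w x = 0"
proof (rule ccontr)
  assume "w x \<noteq> 0"
  have "open {x. w x \<noteq> 0}" by (intro open_Collect_neq assms continuous_intros)
  moreover have "negligible {x. w x \<noteq> 0}"
    using AE_completion[OF assms(2)]
    by (simp add: completion.AE_iff_null_sets negligible_iff_null_sets)
  ultimately show False using open_not_negligible \<open>w x \<noteq> 0\<close> by auto
qed

text \<open>If the gradient vanishes a.e., the mean of \<open>w\<close> over a moving box has zero derivative,
  so it stays constant until the box has left the support of \<open>w\<close>.\<close>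

lemma Lipschitz_zero_gradient:
  fixes w :: "'a::euclidean_space \<Rightarrow> real"
  assumes w: "K-lipschitz_on UNIV w" and grad0: "AE x in lborel. GDERIV w x :> 0"
    and bdd: "bounded U" and out: "\<And>x. x \<notin> U \<Longrightarrow> w x = 0"
  shows "w x = 0"
proof -
  have cont: "continuous_on UNIV w" using w by (rule lipschitz_on_continuous_on)
  then have [measurable]: "w \<in> borel_measurable borel" by (rule borel_measurable_continuous_onI)
  obtain R where R: "\<And>x. x \<in> U \<Longrightarrow> norm x \<le> R" using bdd by (auto simp: bounded_iff)
  have K: "K \<ge> 0" using w by (rule lipschitz_on_nonneg)
  \<comment> \<open>Comparison with a point of norm \<open>|R| + 1\<close>, which lies outside
    \<open>U\<close>, so \<open>w\<close> vanishes there. The bound makes the box integrals below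
    finite.\<close>
  have wb: "\<bar>w x\<bar> \<le> K * (\<bar>R\<bar> + \<bar>R\<bar> + 1)" for x
  proof (cases "x \<in> U")
    case True
    obtain e :: 'a where e: "norm e = 1" by (metis norm_Basis nonempty_Basis ex_in_conv)
    have "w ((\<bar>R\<bar> + 1) *\<^sub>R e) = 0"
      using out[of "(\<bar>R\<bar> + 1) *\<^sub>R e"] R[of "(\<bar>R\<bar> + 1) *\<^sub>R e"] e by force
    then have "\<bar>w x\<bar> \<le> K * dist x ((\<bar>R\<bar> + 1) *\<^sub>R e)"
      using lipschitz_onD[OF w, of x "(\<bar>R\<bar> + 1) *\<^sub>R e"] by (simp add: dist_real_def)
    also have "\<dots> \<le> K * (norm x + norm ((\<bar>R\<bar> + 1) *\<^sub>R e))"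
      unfolding dist_norm using K by (intro mult_left_mono norm_triangle_ineq4)
    also have "\<dots> \<le> K * (\<bar>R\<bar> + \<bar>R\<bar> + 1)"
      using K R[OF True] e by (intro mult_left_mono) auto
    finally show ?thesis .
  qed (use K out in auto)
  obtain e :: 'a where e: "e \<in> Basis" using nonempty_Basis by blast
  have "AE x in lborel. w x = 0"
  proof (rule AE_zero_if_integral_boxes_zero)
    fix a b :: 'a
    define B where "B = cbox a b"
    have Bm [measurable]: "B \<in> sets borel" by (simp add: B_def)
    have iB: "integrable lborel (\<lambda>x. indicator B x * k)" for k :: real
      unfolding B_def using emeasure_bounded_finite[OF bounded_cbox, of a b]
      by (intro integrable_mult_left integrable_real_indicator) auto
    have int: "integrable lborel (\<lambda>x. indicator B x * w (x + v))" for v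
      by (rule Bochner_Integration.integrable_bound[OF iB[of "K * (\<bar>R\<bar> + \<bar>R\<bar> + 1)"]])
        (use wb in \<open>auto simp: indicator_def intro!: AE_I2 order_trans[OF _ abs_ge_self]\<close>)
    show "integrable lborel (\<lambda>x. indicator (cbox a b) x * w x)"
      using int[of 0] by (simp add: B_def)
    define h where "h t = (\<integral>x. indicator B x * w (x + t *\<^sub>R e) \<partial>lborel)" for t
    \<comment> \<open>Dominated convergence along an arbitrary null sequence of increments: the
      quotients are bounded by \<open>K * norm e\<close> and tend almost everywhere to the
      directional derivative, which is 0.\<close>
    have "(h has_field_derivative 0) (at t)" for t
      unfolding DERIV_def tendsto_at_iff_sequentially
    proof (intro allI impI)
      fix X :: "nat \<Rightarrow> real" assume X: "\<forall>i. X i \<in> UNIV - {0}" "X \<longlonglongrightarrow> 0"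
      have X0: "filterlim X (at 0) sequentially" using X by (auto simp: filterlim_at)
      define q where "q n x = indicator B x * ((w (x + t *\<^sub>R e + X n *\<^sub>R e) - w (x + t *\<^sub>R e)) / X n)" for n x
      have "(h (t + X n) - h t) / X n = (\<integral>x. q n x \<partial>lborel)" for n
      proof -
        have "(\<integral>x. q n x \<partial>lborel) = (\<integral>x. (indicator B x * w (x + (t + X n) *\<^sub>R e) - indicator B x * w (x + t *\<^sub>R e)) / X n \<partial>lborel)"
          by (intro Bochner_Integration.integral_cong) (auto simp: q_def algebra_simps)
        also have "\<dots> = (h (t + X n) - h t) / X n"
          by (simp add: h_def Bochner_Integration.integral_diff int)
        finally show ?thesis ..
      qed
      moreover have "(\<lambda>n. \<integral>x. q n x \<partial>lborel) \<longlonglongrightarrow> (\<integral>x. (0::real) \<partial>(lborel::'a measure))"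
      proof (rule integral_dominated_convergence[OF _ _ iB[of "K * norm e"]])
        show "q n \<in> borel_measurable lborel" for n unfolding q_def by measurable
        show "AE x in lborel. (\<lambda>n. q n x) \<longlonglongrightarrow> 0"
          using AE_lborel_translate[OF grad0, of "t *\<^sub>R e"]
        proof eventually_elim
          case (elim x)
          have "(\<lambda>n. (w (x + t *\<^sub>R e + X n *\<^sub>R e) - w (x + t *\<^sub>R e)) / X n) \<longlonglongrightarrow> e \<bullet> 0"
            by (rule filterlim_compose[OF GDERIV_directional[OF elim] X0])
          then show ?case unfolding q_def by (intro tendsto_mult_right_zero) simp
        qed
        show "AE x in lborel. norm (q n x) \<le> indicator B x * (K * norm e)" for n
          using Lipschitz_quotient_bound[OF w] by (intro AE_I2) (auto simp: q_def indicator_def)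
      qed auto
      ultimately show "((\<lambda>s. (h (t + s) - h t) / s) \<circ> X) \<longlonglongrightarrow> 0"
        by (simp add: o_def)
    qed
    then have const: "h 0 = h t" for t using DERIV_isconst_all by blast
    obtain M where M: "\<And>x. x \<in> B \<Longrightarrow> norm x \<le> M"
      using bounded_cbox[of a b] by (auto simp: B_def bounded_iff)
    \<comment> \<open>A shift long enough to carry the whole box, of radius at most
      \<open>M\<close>, out of the ball of radius \<open>R\<close> containing
      \<open>U\<close>.\<close>
    define T where "T = \<bar>R\<bar> + \<bar>M\<bar> + 1"
    have "indicator B x * w (x + T *\<^sub>R e) = 0" for x
    proof (cases "x \<in> B")
      case True
      have "T = norm (T *\<^sub>R e)" using e by (simp add: T_def)
      also have "\<dots> \<le> norm (x + T *\<^sub>R e) + norm x"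
        using norm_triangle_ineq4[of "x + T *\<^sub>R e" x] by simp
      finally have "norm (x + T *\<^sub>R e) > R" using M[OF True] by (simp add: T_def)
      then show ?thesis using R[of "x + T *\<^sub>R e"] out[of "x + T *\<^sub>R e"] by force
    qed simp
    then have "(\<lambda>x. indicator B x * w (x + T *\<^sub>R e)) = (\<lambda>x. 0)" by (rule ext)
    then have "h T = 0" by (simp only: h_def Bochner_Integration.integral_zero)
    then show "(\<integral>x. indicator (cbox a b) x * w x \<partial>lborel) = 0"
      using const[of T] by (simp add: h_def B_def)
  qed
  then show ?thesis by (rule continuous_AE_zero_imp_zero[OF cont])
qed

section \<open>Strict convexity and uniqueness\<close>

text \<open>Zeros of \<open>w\<close> are minima of |w|, so the gradient of |w| vanishes there
  wherever it exists. This suits a function glued to 0 across a boundary, where its values are known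
  but its gradient is not.\<close>

lemma Lipschitz_zero_gradient_off_zeros:
  fixes w :: "'a::euclidean_space \<Rightarrow> real"
  assumes w: "K-lipschitz_on UNIV w" and grad0: "AE x in lborel. w x \<noteq> 0 \<longrightarrow> GDERIV w x :> 0"
    and bdd: "bounded U" and out: "\<And>x. x \<notin> U \<Longrightarrow> w x = 0"
  shows "w x = 0"
proof -
  have cont: "continuous_on UNIV w" using w by (rule lipschitz_on_continuous_on)
  have lip: "K-lipschitz_on UNIV (\<lambda>x. \<bar>w x\<bar>)"
    using lipschitz_onD[OF w] lipschitz_on_nonneg[OF w]
    by (intro lipschitz_onI) (auto simp: dist_real_def intro: order_trans[OF abs_triangle_ineq3])
  have pos: "open {x. 0 < w x}" and neg: "open {x. w x < 0}"
    by (intro open_Collect_less cont continuous_on_const)+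
  have "AE x in lborel. GDERIV (\<lambda>x. \<bar>w x\<bar>) x :> 0"
    using grad0 Lipschitz_AE_GDERIV[OF open_UNIV lip]
  proof eventually_elim
    case (elim x)
    consider "w x = 0" | "w x > 0" | "w x < 0" by linarith
    then show ?case
    proof cases
      case 1
      have D: "GDERIV (\<lambda>x. \<bar>w x\<bar>) x :> grad (\<lambda>x. \<bar>w x\<bar>) x" using elim by auto
      have "(\<lambda>h. h \<bullet> grad (\<lambda>x. \<bar>w x\<bar>) x) = (\<lambda>h. 0)"
        by (rule has_derivative_local_min[OF D[unfolded gderiv_def]]) (simp add: 1)
      then show ?thesis using D by (simp add: gderiv_def)
    next
      case 2
      then have "GDERIV w x :> 0" using elim by auto
      then show ?thesis by (rule GDERIV_transform_within_open[OF _ pos]) (use 2 in auto)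
    next
      case 3
      then have "GDERIV (\<lambda>x. - w x) x :> 0" using elim GDERIV_minus[of w x 0] by auto
      then show ?thesis by (rule GDERIV_transform_within_open[OF _ neg]) (use 3 in auto)
    qed
  qed
  then have "\<bar>w x\<bar> = 0" by (rule Lipschitz_zero_gradient[OF lip _ bdd]) (use out in auto)
  then show ?thesis by simp
qed

lemma power_midpoint_le:
  fixes s t :: real
  assumes "s \<ge> 0" "t \<ge> 0"
  shows "((s + t) / 2) ^ n \<le> (s ^ n + t ^ n) / 2"
proof -
  have c: "convex_on {0::real..} (\<lambda>x. x ^ n)"
    using convex_power_odd[of n] convex_power_even[of n] by (cases "even n") (auto intro: convex_on_subset)
  show ?thesis using convex_onD[OF c, of "1/2" s t] assms by (simp add: field_simps)
qed

text \<open>Only the quadratic term is needed for strictness: the parallelogram law turns it into the defect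
  \<open>a 2 / 4 * |\<xi> - \<eta>|\<^sup>2\<close>, the other terms being merely convex.\<close>

lemma G_energy_midpoint:
  fixes \<xi> \<eta> :: "'a::euclidean_space"
  assumes a: "\<And>p. p \<ge> 2 \<Longrightarrow> a p \<ge> 0"
  shows "2 * G_energy a \<sigma> ((1/2) *\<^sub>R (\<xi> + \<eta>)) + ennreal (a 2 / 4 * (norm (\<xi> - \<eta>))\<^sup>2)
     \<le> G_energy a \<sigma> \<xi> + G_energy a \<sigma> \<eta>"
proof (cases "norm \<xi> \<le> \<sigma> \<and> norm \<eta> \<le> \<sigma>")
  case True
  then have \<sigma>: "norm \<xi> \<le> \<sigma>" "norm \<eta> \<le> \<sigma>" by auto
  define m where "m = norm ((1/2) *\<^sub>R (\<xi> + \<eta>))"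
  define c where "c = a 2 / 4 * (norm (\<xi> - \<eta>))\<^sup>2"
  define T where "T p t = a (p + 2) / real (p + 2) * t ^ (p + 2)" for p and t :: real
  have T0: "T p t \<ge> 0" if "t \<ge> 0" for p t using a[of "p + 2"] that by (simp add: T_def)
  have c0: "c \<ge> 0" using a[of 2] by (simp add: c_def)
  have m2: "2 * m \<le> norm \<xi> + norm \<eta>" using norm_triangle_ineq[of \<xi> \<eta>] by (simp add: m_def)
  then have m: "m \<le> (norm \<xi> + norm \<eta>) / 2" by simp
  have m0: "m \<ge> 0" by (simp add: m_def)
  have m\<sigma>: "m \<le> \<sigma>" using m2 \<sigma> by simp
  \<comment> \<open>Index 0 is the quadratic term, the series being shifted by two. There the
    parallelogram law gives equality with the defect \<open>c\<close>; every other index contributes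
    only convexity.\<close>
  have main: "2 * T p m + (if p = 0 then c else 0) \<le> T p (norm \<xi>) + T p (norm \<eta>)" for p
  proof (cases "p = 0")
    case True
    have "4 * m\<^sup>2 + (norm (\<xi> - \<eta>))\<^sup>2 = 2 * (norm \<xi>)\<^sup>2 + 2 * (norm \<eta>)\<^sup>2"
      by (simp add: m_def power_divide power2_norm_eq_inner inner_simps inner_commute power_mult_distrib field_simps)
    then have "a 2 / 4 * (4 * m\<^sup>2 + (norm (\<xi> - \<eta>))\<^sup>2) = a 2 / 4 * (2 * (norm \<xi>)\<^sup>2 + 2 * (norm \<eta>)\<^sup>2)" by simp
    then show ?thesis using True by (simp add: T_def c_def algebra_simps numeral_2_eq_2[symmetric])
  next
    case False
    define k where "k = a (p + 2) / real (p + 2)"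
    have k: "k \<ge> 0" using a[of "p + 2"] by (simp add: k_def)
    have "m ^ (p + 2) \<le> ((norm \<xi> + norm \<eta>) / 2) ^ (p + 2)" using m m0 by (intro power_mono) auto
    also have "\<dots> \<le> (norm \<xi> ^ (p + 2) + norm \<eta> ^ (p + 2)) / 2" by (rule power_midpoint_le) auto
    finally have "2 * m ^ (p + 2) \<le> norm \<xi> ^ (p + 2) + norm \<eta> ^ (p + 2)"
      by (simp only: le_divide_eq_numeral1 mult.commute)
    then have "k * (2 * m ^ (p + 2)) \<le> k * (norm \<xi> ^ (p + 2) + norm \<eta> ^ (p + 2))"
      using k by (rule mult_left_mono)
    then have "2 * T p m \<le> T p (norm \<xi>) + T p (norm \<eta>)"
      unfolding T_def k_def[symmetric] distrib_left by (simp only: mult.left_commute)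
    then show ?thesis using False by simp
  qed
  have Phi: "Phi a t = (\<Sum>p. ennreal (T p t))" for t by (simp add: Phi_def T_def)
  have "2 * Phi a m + ennreal c = (\<Sum>p. 2 * ennreal (T p m)) + (\<Sum>p. if p = 0 then ennreal c else 0)"
    by (subst sums_unique[OF sums_single, symmetric]) (simp add: Phi)
  also have "\<dots> = (\<Sum>p. 2 * ennreal (T p m) + (if p = 0 then ennreal c else 0))"
    by (rule suminf_add) auto
  also have "\<dots> \<le> (\<Sum>p. ennreal (T p (norm \<xi>)) + ennreal (T p (norm \<eta>)))"
  proof (rule suminf_le)
    fix p
    have "2 * ennreal (T p m) + (if p = 0 then ennreal c else 0) = ennreal (2 * T p m + (if p = 0 then c else 0))"
      using T0[OF m0, of p] c0 by (auto simp: ennreal_plus ennreal_mult)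
    also have "\<dots> \<le> ennreal (T p (norm \<xi>) + T p (norm \<eta>))"
      using main by (rule ennreal_leI)
    also have "\<dots> = ennreal (T p (norm \<xi>)) + ennreal (T p (norm \<eta>))"
      using T0 by (intro ennreal_plus) auto
    finally show "2 * ennreal (T p m) + (if p = 0 then ennreal c else 0) \<le> \<dots>" .
  qed auto
  also have "\<dots> = (\<Sum>p. ennreal (T p (norm \<xi>))) + (\<Sum>p. ennreal (T p (norm \<eta>)))"
    by (rule suminf_add[symmetric]) auto
  also have "\<dots> = Phi a (norm \<xi>) + Phi a (norm \<eta>)"
    by (simp only: Phi)
  finally have "2 * Phi a m + ennreal c \<le> Phi a (norm \<xi>) + Phi a (norm \<eta>)" .
  moreover have "G_energy a \<sigma> ((1/2) *\<^sub>R (\<xi> + \<eta>)) = Phi a m"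
    unfolding G_energy_def m_def[symmetric] using m\<sigma> by simp
  ultimately show ?thesis using \<sigma> by (simp add: G_energy_def c_def)
next
  case False
  then have *: "G_energy a \<sigma> \<xi> + G_energy a \<sigma> \<eta> = top"
    by (auto simp: G_energy_def)
  show ?thesis unfolding * by simp
qed

lemma G_energy_measurable [measurable]: "G_energy a \<sigma> \<in> borel_measurable borel"
  unfolding G_energy_def[abs_def] Phi_def by measurable

lemma GDERIV_midpoint:
  fixes u v :: "'a::euclidean_space \<Rightarrow> real"
  assumes "GDERIV u x :> D" "GDERIV v x :> E"
  shows "GDERIV (\<lambda>x. (u x + v x) / 2) x :> (1/2) *\<^sub>R (D + E)"
proof -
  have "((\<lambda>x. (u x + v x) / 2) has_derivative (\<lambda>h. (h \<bullet> D + h \<bullet> E) / 2)) (at x)"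
    using assms unfolding gderiv_def by (auto intro!: derivative_eq_intros)
  then show ?thesis unfolding gderiv_def
    by (rule has_derivative_eq_rhs) (auto simp: inner_simps)
qed

lemma grad_midpoint_AE:
  fixes u v :: "'a::euclidean_space \<Rightarrow> real"
  assumes "open \<Omega>" "C-lipschitz_on \<Omega> u" "K-lipschitz_on \<Omega> v"
  shows "AE x in lebesgue_on \<Omega>. grad (\<lambda>x. (u x + v x) / 2) x = (1/2) *\<^sub>R (grad u x + grad v x)"
  unfolding AE_lebesgue_on_iff[OF assms(1)]
  using Lipschitz_AE_GDERIV[OF assms(1,2)] Lipschitz_AE_GDERIV[OF assms(1,3)]
  by eventually_elim (auto intro!: grad_eqI GDERIV_midpoint)

text \<open>The defect is written as a summand on the smaller side because the energies may be
  infinite and cannot be subtracted.\<close>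

lemma energy_midpoint:
  fixes u v :: "'a::euclidean_space \<Rightarrow> real"
  assumes op: "open \<Omega>" and u: "C-lipschitz_on \<Omega> u" and v: "K-lipschitz_on \<Omega> v"
    and a: "\<And>p. p \<ge> 2 \<Longrightarrow> a p \<ge> 0"
  shows "2 * (\<integral>\<^sup>+x. G_energy a \<sigma> (grad (\<lambda>x. (u x + v x) / 2) x) \<partial>lebesgue_on \<Omega>)
      + (\<integral>\<^sup>+x. ennreal (a 2 / 4 * (norm (grad u x - grad v x))\<^sup>2) \<partial>lebesgue_on \<Omega>)
    \<le> (\<integral>\<^sup>+x. G_energy a \<sigma> (grad u x) \<partial>lebesgue_on \<Omega>) + (\<integral>\<^sup>+x. G_energy a \<sigma> (grad v x) \<partial>lebesgue_on \<Omega>)"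
proof -
  note [measurable] = grad_measurable[OF op u] grad_measurable[OF op v]
  let ?G = "\<lambda>x. G_energy a \<sigma> ((1/2) *\<^sub>R (grad u x + grad v x))"
  let ?d = "\<lambda>x. ennreal (a 2 / 4 * (norm (grad u x - grad v x))\<^sup>2)"
  have eq: "(\<integral>\<^sup>+x. G_energy a \<sigma> (grad (\<lambda>x. (u x + v x) / 2) x) \<partial>lebesgue_on \<Omega>) = (\<integral>\<^sup>+x. ?G x \<partial>lebesgue_on \<Omega>)"
  proof (rule nn_integral_cong_AE)
    show "AE x in lebesgue_on \<Omega>. G_energy a \<sigma> (grad (\<lambda>x. (u x + v x) / 2) x) = ?G x"
      using grad_midpoint_AE[OF op u v] by eventually_elim (simp only:)
  qed
  have "2 * (\<integral>\<^sup>+x. ?G x \<partial>lebesgue_on \<Omega>) + (\<integral>\<^sup>+x. ?d x \<partial>lebesgue_on \<Omega>) = (\<integral>\<^sup>+x. 2 * ?G x + ?d x \<partial>lebesgue_on \<Omega>)"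
  proof -
    have "(\<integral>\<^sup>+x. 2 * ?G x + ?d x \<partial>lebesgue_on \<Omega>) = (\<integral>\<^sup>+x. 2 * ?G x \<partial>lebesgue_on \<Omega>) + (\<integral>\<^sup>+x. ?d x \<partial>lebesgue_on \<Omega>)"
      by (rule nn_integral_add) measurable
    also have "(\<integral>\<^sup>+x. 2 * ?G x \<partial>lebesgue_on \<Omega>) = 2 * (\<integral>\<^sup>+x. ?G x \<partial>lebesgue_on \<Omega>)"
      by (rule nn_integral_cmult) measurable
    finally show ?thesis ..
  qed
  also have "\<dots> \<le> (\<integral>\<^sup>+x. G_energy a \<sigma> (grad u x) + G_energy a \<sigma> (grad v x) \<partial>lebesgue_on \<Omega>)"
  proof (rule nn_integral_mono)
    fix x
    show "2 * ?G x + ?d x \<le> G_energy a \<sigma> (grad u x) + G_energy a \<sigma> (grad v x)"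
      by (rule G_energy_midpoint) (rule a)
  qed
  also have "\<dots> = (\<integral>\<^sup>+x. G_energy a \<sigma> (grad u x) \<partial>lebesgue_on \<Omega>) + (\<integral>\<^sup>+x. G_energy a \<sigma> (grad v x) \<partial>lebesgue_on \<Omega>)"
    by (rule nn_integral_add) measurable
  finally show ?thesis unfolding eq .
qed

section \<open>Finite energies, admissible midpoints and uniqueness\<close>

lemma Lipschitz_integrable:
  fixes v :: "'a::euclidean_space \<Rightarrow> real"
  assumes "bounded \<Omega>" "open \<Omega>" "C-lipschitz_on \<Omega> v"
  shows "integrable (lebesgue_on \<Omega>) v"
proof -
  have lm: "\<Omega> \<in> lmeasurable" using assms by (intro bounded_set_imp_lmeasurable) auto
  have cont: "continuous_on \<Omega> v" using assms(3) by (rule lipschitz_on_continuous_on)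
  have "bounded (v ` \<Omega>)"
    using assms by (intro bounded_uniformly_continuous_image lipschitz_on_uniformly_continuous[OF assms(3)])
  then obtain M where M: "\<And>x. x \<in> \<Omega> \<Longrightarrow> norm (v x) \<le> M" by (auto simp: bounded_iff)
  interpret finite_measure "lebesgue_on \<Omega>" using lm by (rule finite_measure_lebesgue_on)
  show ?thesis
    using M cont assms(2)
    by (intro integrable_const_bound[where B = M]) (auto intro!: AE_I2 continuous_imp_measurable_on_sets_lebesgue)
qed

lemma F_energy_finite:
  assumes "F_energy a \<sigma> \<Omega> f v < \<infinity>"
  obtains e where "e \<ge> 0" "(\<integral>\<^sup>+x. G_energy a \<sigma> (grad v x) \<partial>lebesgue_on \<Omega>) = ennreal e"
proof -
  have "(\<integral>\<^sup>+x. G_energy a \<sigma> (grad v x) \<partial>lebesgue_on \<Omega>) \<noteq> \<infinity>"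
    using assms by (auto simp: F_energy_def)
  then show ?thesis using that
    by (cases "(\<integral>\<^sup>+x. G_energy a \<sigma> (grad v x) \<partial>lebesgue_on \<Omega>)") auto
qed

lemma F_energy_real:
  assumes "(\<integral>\<^sup>+x. G_energy a \<sigma> (grad v x) \<partial>lebesgue_on \<Omega>) = ennreal e" "e \<ge> 0"
  shows "F_energy a \<sigma> \<Omega> f v = ereal (e - (\<integral>x. f x * v x \<partial>lebesgue_on \<Omega>))"
  using assms by (simp add: F_energy_def enn2ereal_ennreal)

lemma admissible_midpoint:
  fixes u v :: "'a::euclidean_space \<Rightarrow> real"
  assumes op: "open \<Omega>" and u: "u \<in> admissible \<Omega> \<sigma> g" and v: "v \<in> admissible \<Omega> \<sigma> g"
  shows "(\<lambda>x. (u x + v x) / 2) \<in> admissible \<Omega> \<sigma> g"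
proof -
  obtain C K where C: "C-lipschitz_on (closure \<Omega>) u" and K: "K-lipschitz_on (closure \<Omega>) v"
    using u v by (auto simp: admissible_def lipschitz_fun_def)
  have CK: "C-lipschitz_on \<Omega> u" "K-lipschitz_on \<Omega> v"
    using lipschitz_on_subset[OF C closure_subset] lipschitz_on_subset[OF K closure_subset] by auto
  have "((1/2) * (C + K))-lipschitz_on (closure \<Omega>) (\<lambda>x. (1/2) * (u x + v x))"
    by (intro lipschitz_on_cmult_real_nonneg lipschitz_on_add C K) auto
  then have "lipschitz_fun (closure \<Omega>) (\<lambda>x. (u x + v x) / 2)"
    by (auto simp: lipschitz_fun_def)
  moreover have "AE x in lebesgue_on \<Omega>. norm (grad (\<lambda>x. (u x + v x) / 2) x) \<le> \<sigma>"
  proof -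
    have "AE x in lebesgue_on \<Omega>. norm (grad u x) \<le> \<sigma>" "AE x in lebesgue_on \<Omega>. norm (grad v x) \<le> \<sigma>"
      using u v by (auto simp: admissible_def)
    with grad_midpoint_AE[OF op CK] show ?thesis
    proof eventually_elim
      case (elim x)
      then show ?case using norm_triangle_ineq[of "grad u x" "grad v x"] by simp
    qed
  qed
  ultimately show ?thesis using u v by (auto simp: admissible_def)
qed

text \<open>The load term is affine, so the midpoint of two minimizers would have less energy unless
  the gradients agree almost everywhere. The difference then vanishes on the boundary and has zero
  gradient inside.\<close>

proposition minimizer_unique:
  fixes u v :: "'a::euclidean_space \<Rightarrow> real"
  assumes op: "open \<Omega>" and bd: "bounded \<Omega>" and a: "\<And>p. p \<ge> 2 \<Longrightarrow> a p \<ge> 0" and a2: "a 2 > 0"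
    and u: "is_minimizer a \<sigma> \<Omega> (\<lambda>_. lam) g u" and v: "is_minimizer a \<sigma> \<Omega> (\<lambda>_. lam) g v"
    and fin: "F_energy a \<sigma> \<Omega> (\<lambda>_. lam) u < \<infinity>"
    and x: "x \<in> \<Omega>"
  shows "u x = v x"
proof -
  let ?E = "\<lambda>v. \<integral>\<^sup>+x. G_energy a \<sigma> (grad v x) \<partial>lebesgue_on \<Omega>"
  let ?m = "\<lambda>x. (u x + v x) / 2"
  have ua: "u \<in> admissible \<Omega> \<sigma> g" and va: "v \<in> admissible \<Omega> \<sigma> g"
    using u v by (auto simp: is_minimizer_def)
  have ma: "?m \<in> admissible \<Omega> \<sigma> g" using op ua va by (rule admissible_midpoint)
  obtain C K where C: "C-lipschitz_on (closure \<Omega>) u" and K: "K-lipschitz_on (closure \<Omega>) v"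
    using ua va by (auto simp: admissible_def lipschitz_fun_def)
  have C': "C-lipschitz_on \<Omega> u" and K': "K-lipschitz_on \<Omega> v"
    using lipschitz_on_subset[OF C closure_subset] lipschitz_on_subset[OF K closure_subset] by auto
  have Fuv: "F_energy a \<sigma> \<Omega> (\<lambda>_. lam) u = F_energy a \<sigma> \<Omega> (\<lambda>_. lam) v"
    using u v by (auto simp: is_minimizer_def intro!: antisym)
  have Fum: "F_energy a \<sigma> \<Omega> (\<lambda>_. lam) u \<le> F_energy a \<sigma> \<Omega> (\<lambda>_. lam) ?m"
    using u ma by (auto simp: is_minimizer_def)
  obtain e1 where e1: "e1 \<ge> 0" "?E u = ennreal e1" using F_energy_finite[OF fin] .
  obtain e2 where e2: "e2 \<ge> 0" "?E v = ennreal e2" using F_energy_finite[of a \<sigma> \<Omega> "\<lambda>_. lam" v] fin Fuv by auto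
  define D where "D = (\<integral>\<^sup>+x. ennreal (a 2 / 4 * (norm (grad u x - grad v x))\<^sup>2) \<partial>lebesgue_on \<Omega>)"
  have mid: "2 * ?E ?m + D \<le> ennreal e1 + ennreal e2"
    unfolding D_def e1(2)[symmetric] e2(2)[symmetric]
    by (rule energy_midpoint[OF op C' K']) (rule a)
  \<comment> \<open>The convexity inequality itself bounds the midpoint energy and the defect, so
    all the quantities become real and may be subtracted.\<close>
  have "2 * ?E ?m \<noteq> \<infinity>" "D \<noteq> \<infinity>"
    using mid by (auto simp: top_unique ennreal_plus[symmetric] simp del: ennreal_plus)
  then have "?E ?m \<noteq> \<infinity>" by (auto simp: ennreal_mult_eq_top_iff)
  then obtain em where em: "em \<ge> 0" "?E ?m = ennreal em"
    by (cases "?E ?m") auto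
  obtain d where d: "d \<ge> 0" "D = ennreal d"
    using \<open>D \<noteq> \<infinity>\<close> by (cases D) auto
  have "2 * ennreal em + ennreal d = ennreal (2 * em + d)"
    using em d by (simp add: ennreal_plus ennreal_mult)
  then have "ennreal (2 * em + d) \<le> ennreal (e1 + e2)"
    using mid em d e1 e2 by (simp add: ennreal_plus)
  then have 1: "2 * em + d \<le> e1 + e2"
    using e1 e2 by (subst (asm) ennreal_le_iff) auto
  define I where "I v = (\<integral>x. lam * v x \<partial>lebesgue_on \<Omega>)" for v
  have iu: "integrable (lebesgue_on \<Omega>) u" "integrable (lebesgue_on \<Omega>) v"
    using Lipschitz_integrable[OF bd op C'] Lipschitz_integrable[OF bd op K'] by auto
  have "I ?m = (\<integral>x. (lam * u x) / 2 + (lam * v x) / 2 \<partial>lebesgue_on \<Omega>)"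
    unfolding I_def by (intro Bochner_Integration.integral_cong) (auto simp: algebra_simps)
  then have Im: "I ?m = (I u + I v) / 2" using iu by (simp add: I_def)
  have 2: "e1 - I u = e2 - I v"
    using Fuv F_energy_real[OF e1(2,1), of "\<lambda>_. lam"] F_energy_real[OF e2(2,1), of "\<lambda>_. lam"] by (simp add: I_def)
  have 3: "e1 - I u \<le> em - I ?m"
    using Fum F_energy_real[OF e1(2,1), of "\<lambda>_. lam"] F_energy_real[OF em(2,1), of "\<lambda>_. lam"] by (simp add: I_def)
  \<comment> \<open>Minimality gives e1 - I u \<le> em - (I u + I v) / 2, and the same for e2 - I v.
    Adding the two and comparing with 2 em + d \<le> e1 + e2 leaves d \<le> 0.\<close>
  have "d = 0" using 1 2 3 Im d(1) by (simp add: field_simps)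
  then have "D = 0" using d by simp
  moreover note [measurable] = grad_measurable[OF op C'] grad_measurable[OF op K']
  ultimately have "AE x in lebesgue_on \<Omega>. ennreal (a 2 / 4 * (norm (grad u x - grad v x))\<^sup>2) = 0"
    unfolding D_def by (subst (asm) nn_integral_0_iff_AE) auto
  then have "AE x in lebesgue_on \<Omega>. grad u x = grad v x"
    by eventually_elim (use a2 in \<open>auto simp: ennreal_eq_0_iff mult_le_0_iff\<close>)
  then have gr: "AE x in lborel. x \<in> \<Omega> \<longrightarrow> grad u x = grad v x"
    by (simp add: AE_lebesgue_on_iff[OF op])
  \<comment> \<open>The values of \<open>u\<close> and \<open>v\<close> outside the closure of
    \<Omega> carry no information, so the difference is replaced by 0 there.\<close>
  define w where "w x = (if x \<in> \<Omega> then u x - v x else 0)" for x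
  have bdry: "u x = v x" if "x \<in> frontier \<Omega>" for x using ua va that by (auto simp: admissible_def)
  have wl: "(C + K)-lipschitz_on UNIV w"
  proof (rule Lipschitz_zero_extension[of _ \<Omega> "\<lambda>x. u x - v x"])
    show "(C + K)-lipschitz_on (closure \<Omega>) (\<lambda>x. u x - v x)" using C K by (rule lipschitz_on_diff)
    show "w x = u x - v x" if "x \<in> closure \<Omega>" for x
      using that bdry[of x] op by (auto simp: w_def frontier_def interior_open)
    show "w x = 0" if "x \<in> frontier \<Omega>" for x
      using that op by (auto simp: w_def frontier_def interior_open)
  qed (auto simp: w_def)
  have "AE x in lborel. w x \<noteq> 0 \<longrightarrow> GDERIV w x :> 0"
    using gr Lipschitz_AE_GDERIV[OF op C'] Lipschitz_AE_GDERIV[OF op K']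
  proof eventually_elim
    case (elim x)
    show ?case
    proof
      assume "w x \<noteq> 0"
      then have x: "x \<in> \<Omega>" by (auto simp: w_def split: if_splits)
      have "GDERIV (\<lambda>x. u x - v x) x :> (grad u x - grad v x)"
        using elim x by (intro GDERIV_diff) auto
      then have "GDERIV (\<lambda>x. u x - v x) x :> 0" using elim x by simp
      then show "GDERIV w x :> 0"
        by (rule GDERIV_transform_within_open[OF _ op x]) (simp add: w_def)
    qed
  qed
  then have "w x = 0" by (rule Lipschitz_zero_gradient_off_zeros[OF wl _ bd]) (simp add: w_def)
  then show ?thesis using x by (simp add: w_def)
qed

section \<open>Comparison by translation\<close>

text \<open>A zero of the nonnegative \<open>w\<close> is a minimum, so the gradient of
  \<open>w\<close> vanishes there if it exists. This covers the edge of {w > 0} without any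
  information on its measure.\<close>

lemma grad_add_at_zeros_AE:
  fixes u w :: "'a::euclidean_space \<Rightarrow> real"
  assumes op: "open \<Omega>" and u: "C-lipschitz_on \<Omega> u" and w: "K-lipschitz_on UNIV w"
    and w0: "\<And>x. w x \<ge> 0"
  shows "AE x in lborel. x \<in> \<Omega> \<and> w x = 0 \<longrightarrow> grad (\<lambda>x. u x + c * w x) x = grad u x"
  using Lipschitz_AE_GDERIV[OF op u] Lipschitz_AE_GDERIV[OF open_UNIV w]
proof eventually_elim
  case (elim x)
  show ?case
  proof
    assume x: "x \<in> \<Omega> \<and> w x = 0"
    have W: "GDERIV w x :> grad w x" and U: "GDERIV u x :> grad u x" using elim x by auto
    have W0: "(\<lambda>h. h \<bullet> grad w x) = (\<lambda>h. 0)"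
      by (rule has_derivative_local_min[OF W[unfolded gderiv_def]]) (use x w0 in auto)
    have "(w has_derivative (\<lambda>h. 0)) (at x)" using W unfolding gderiv_def W0 .
    then have "((\<lambda>x. u x + c * w x) has_derivative (\<lambda>h. h \<bullet> grad u x + c * 0)) (at x)"
      using U unfolding gderiv_def by (intro has_derivative_add has_derivative_mult_right) auto
    then show "grad (\<lambda>x. u x + c * w x) x = grad u x"
      by (intro grad_eqI) (simp add: gderiv_def)
  qed
qed

text \<open>The Lipschitz constant of the sum may well exceed \<sigma>; admissibility restricts only
  the gradient, which is left to the caller.\<close>

lemma admissible_perturbation:
  fixes u w :: "'a::euclidean_space \<Rightarrow> real"
  assumes op: "open \<Omega>" and u: "u \<in> admissible \<Omega> \<sigma> g" and w: "K-lipschitz_on (closure \<Omega>) w"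
    and fr: "\<And>x. x \<in> frontier \<Omega> \<Longrightarrow> w x = 0"
    and gr: "AE x in lborel. x \<in> \<Omega> \<longrightarrow> norm (grad (\<lambda>x. u x + c * w x) x) \<le> \<sigma>"
  shows "(\<lambda>x. u x + c * w x) \<in> admissible \<Omega> \<sigma> g"
proof -
  obtain C where C: "C-lipschitz_on (closure \<Omega>) u"
    using u by (auto simp: admissible_def lipschitz_fun_def)
  have "(C + \<bar>c\<bar> * K)-lipschitz_on (closure \<Omega>) (\<lambda>x. u x + c * w x)"
    by (intro lipschitz_on_add C lipschitz_on_cmult_real w)
  then have "lipschitz_fun (closure \<Omega>) (\<lambda>x. u x + c * w x)" by (auto simp: lipschitz_fun_def)
  then show ?thesis using u gr fr by (auto simp: admissible_def AE_lebesgue_on_iff[OF op])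
qed

text \<open>On the overlap \<open>v1\<close> is the maximum of \<open>u x\<close> and
  \<open>u (x + \<tau>) - M\<close>; on the shifted overlap \<open>v2\<close> is the minimum of
  \<open>u x\<close> and \<open>u (x - \<tau>) + M\<close>. The number \<open>M\<close> enters only
  through comparison at pairs having a point on the boundary.\<close>

proposition minimizer_translation_bound:
  fixes u :: "'a::euclidean_space \<Rightarrow> real"
  assumes op: "open \<Omega>" and bd: "bounded \<Omega>" and a: "\<And>p. p \<ge> 2 \<Longrightarrow> a p \<ge> 0" and a2: "a 2 > 0"
    and min: "is_minimizer a \<sigma> \<Omega> (\<lambda>_. lam) g u"
    and fin: "F_energy a \<sigma> \<Omega> (\<lambda>_. lam) u < \<infinity>"
    and bdry: "\<And>x. x \<in> closure \<Omega> \<Longrightarrow> x + \<tau> \<in> closure \<Omega> \<Longrightarrow> x \<in> frontier \<Omega> \<or> x + \<tau> \<in> frontier \<Omega> \<Longrightarrow>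
      u (x + \<tau>) - u x \<le> M"
    and z: "z \<in> \<Omega>" "z + \<tau> \<in> \<Omega>"
  shows "u (z + \<tau>) - u z \<le> M"
proof -
  let ?E = "\<lambda>v. \<integral>\<^sup>+x. G_energy a \<sigma> (grad v x) \<partial>lebesgue_on \<Omega>"
  let ?F = "F_energy a \<sigma> \<Omega> (\<lambda>_. lam)"
  have ua: "u \<in> admissible \<Omega> \<sigma> g" using min by (simp add: is_minimizer_def)
  then obtain C where C: "C-lipschitz_on (closure \<Omega>) u"
    by (auto simp: admissible_def lipschitz_fun_def)
  have C': "C-lipschitz_on \<Omega> u" using C closure_subset by (rule lipschitz_on_subset)
  have C0: "C \<ge> 0" using C by (rule lipschitz_on_nonneg)
  define O' where "O' = \<Omega> \<inter> (\<lambda>x. x + \<tau>) -` \<Omega>"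
  have O_open: "open O'" unfolding O'_def by (intro open_Int op open_vimage continuous_intros)
  define w' where "w' x = max 0 (u (x + \<tau>) - M - u x)" for x
  define w where "w x = (if x \<in> O' then w' x else 0)" for x
  have clO: "x \<in> closure \<Omega>" "x + \<tau> \<in> closure \<Omega>" if "x \<in> closure O'" for x
  proof -
    have "closure O' \<subseteq> closure \<Omega> \<inter> (\<lambda>x. x + \<tau>) -` closure \<Omega>"
      using closure_subset by (intro closure_minimal closed_Int closed_vimage continuous_intros) (auto simp: O'_def)
    then show "x \<in> closure \<Omega>" "x + \<tau> \<in> closure \<Omega>" using that by auto
  qed
  have w'0: "w' x = 0" if x: "x \<in> closure O'" "x \<notin> O'" for x
  proof -
    \<comment> \<open>Both \<open>x\<close> and \<open>x + \<tau>\<close> lie in the closure of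
      \<Omega>, and outside the overlap at least one of them is not in the open set
      \<Omega>.\<close>
    have "x \<in> frontier \<Omega> \<or> x + \<tau> \<in> frontier \<Omega>"
      using clO[OF x(1)] x(2) op by (auto simp: O'_def frontier_def interior_open)
    then show ?thesis using bdry[OF clO[OF x(1)]] by (simp add: w'_def)
  qed
  have wlip: "(2 * C)-lipschitz_on UNIV w"
  proof (rule Lipschitz_zero_extension[of _ O' w'])
    show "(2 * C)-lipschitz_on (closure O') w'"
    proof (rule lipschitz_onI)
      fix x y assume x: "x \<in> closure O'" and y: "y \<in> closure O'"
      have "\<bar>u (x + \<tau>) - u (y + \<tau>)\<bar> \<le> C * dist x y" "\<bar>u x - u y\<bar> \<le> C * dist x y"
        using lipschitz_onD[OF C clO(2)[OF x] clO(2)[OF y]] lipschitz_onD[OF C clO(1)[OF x] clO(1)[OF y]]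
        by (simp_all add: dist_norm)
      then show "dist (w' x) (w' y) \<le> 2 * C * dist x y"
        by (simp add: w'_def dist_real_def max_def abs_if split: if_splits)
    qed (use C0 in simp)
    show "w x = w' x" if "x \<in> closure O'" for x using w'0[of x] that by (auto simp: w_def)
    show "w x = 0" if "x \<in> frontier O'" for x
      using that O_open by (auto simp: w_def frontier_def interior_open)
  qed (simp add: w_def)
  have w0: "w x \<ge> 0" for x by (simp add: w_def w'_def)
  define wt where "wt y = w (y - \<tau>)" for y
  have wtlip: "(2 * C)-lipschitz_on UNIV wt"
  proof (rule lipschitz_onI)
    fix x y show "dist (wt x) (wt y) \<le> 2 * C * dist x y"
      using lipschitz_onD[OF wlip, of "x - \<tau>" "y - \<tau>"] by (simp add: wt_def dist_norm)
  qed (use C0 in simp)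
  have wt0: "wt x \<ge> 0" for x by (simp add: wt_def w0)
  have wout: "w x = 0" "wt x = 0" if "x \<notin> \<Omega>" for x
    using that by (auto simp: w_def wt_def O'_def)
  have frw: "w x = 0" "wt x = 0" if "x \<in> frontier \<Omega>" for x
    using that op by (auto simp: frontier_def interior_open intro!: wout)
  \<comment> \<open>The factors 1 and -1 are kept so that both competitors match the pattern u + c w
    of the two preceding lemmas.\<close>
  define v1 where "v1 x = u x + 1 * w x" for x
  define v2 where "v2 x = u x + (-1) * wt x" for x
  define A where "A = {x. 0 < w x}"
  have wcont: "continuous_on UNIV w" using wlip by (rule lipschitz_on_continuous_on)
  have A_open: "open A" unfolding A_def by (intro open_Collect_less wcont continuous_on_const)
  have A_sub: "x \<in> \<Omega>" "x + \<tau> \<in> \<Omega>" "w x = u (x + \<tau>) - M - u x" if "x \<in> A" for x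
    using that by (auto simp: A_def w_def O'_def w'_def max_def split: if_splits)
  have notA: "w x = 0" if "x \<notin> A" for x using that w0[of x] by (simp add: A_def)
  have [measurable]: "A \<in> sets borel" "\<Omega> \<in> sets borel" "w \<in> borel_measurable borel"
    using A_open op wcont by (auto intro: borel_measurable_continuous_onI)
  have gA1: "grad v1 x = grad u (x + \<tau>)" if "x \<in> A" for x
  proof -
    have "grad v1 x = grad (\<lambda>y. u (y + \<tau>) + (- M)) x"
      by (rule grad_cong_open[OF A_open that]) (auto simp: v1_def A_sub(3))
    then show ?thesis by (simp only: grad_translate_add_const)
  qed
  have gA2: "grad v2 x = grad u (x - \<tau>)" if "x - \<tau> \<in> A" for x
  proof -
    have "open ((\<lambda>y. y - \<tau>) -` A)" by (intro open_vimage A_open continuous_intros)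
    then have "grad v2 x = grad (\<lambda>y. u (y + (- \<tau>)) + M) x"
      by (rule grad_cong_open) (use that A_sub(3) in \<open>auto simp: v2_def wt_def\<close>)
    then show ?thesis by (simp only: grad_translate_add_const) simp
  qed
  have g1: "AE x in lborel. x \<in> \<Omega> \<longrightarrow> grad v1 x = (if x \<in> A then grad u (x + \<tau>) else grad u x)"
    using grad_add_at_zeros_AE[OF op C' wlip w0, of 1]
    by eventually_elim (use gA1 notA in \<open>auto simp: v1_def[abs_def]\<close>)
  have g2: "AE x in lborel. x \<in> \<Omega> \<longrightarrow> grad v2 x = (if x - \<tau> \<in> A then grad u (x - \<tau>) else grad u x)"
    using grad_add_at_zeros_AE[OF op C' wtlip wt0, of "-1"]
    by eventually_elim (use gA2 notA in \<open>auto simp: v2_def[abs_def] wt_def\<close>)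
  have s0: "AE x in lborel. x \<in> \<Omega> \<longrightarrow> norm (grad u x) \<le> \<sigma>"
    using ua by (simp add: admissible_def AE_lebesgue_on_iff[OF op])
  have v1a: "v1 \<in> admissible \<Omega> \<sigma> g"
    unfolding v1_def[abs_def]
  proof (rule admissible_perturbation[OF op ua lipschitz_on_subset[OF wlip subset_UNIV] frw(1)])
    show "AE x in lborel. x \<in> \<Omega> \<longrightarrow> norm (grad (\<lambda>x. u x + 1 * w x) x) \<le> \<sigma>"
      using g1 s0 AE_lborel_translate[OF s0, of \<tau>] unfolding v1_def[abs_def]
      by eventually_elim (use A_sub in auto)
  qed
  have v2a: "v2 \<in> admissible \<Omega> \<sigma> g"
    unfolding v2_def[abs_def]
  proof (rule admissible_perturbation[OF op ua lipschitz_on_subset[OF wtlip subset_UNIV] frw(2)])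
    show "AE x in lborel. x \<in> \<Omega> \<longrightarrow> norm (grad (\<lambda>x. u x + (-1) * wt x) x) \<le> \<sigma>"
      using g2 s0 AE_lborel_translate[OF s0, of "- \<tau>"] unfolding v2_def[abs_def]
      by eventually_elim (use A_sub in auto)
  qed
  \<comment> \<open>Translating an integral requires a Borel integrand on the whole space, so the
    gradient is replaced by its representative.\<close>
  obtain D where D [measurable]: "D \<in> borel_measurable borel" and uD: "AE x in lborel. x \<in> \<Omega> \<longrightarrow> grad u x = D x"
    using Lipschitz_AE_grad[OF op C'] by metis
  define G where "G x = G_energy a \<sigma> (D x) * indicator \<Omega> x" for x
  have [measurable]: "G \<in> borel_measurable borel" unfolding G_def by measurable
  \<comment> \<open>The energy of \<open>u\<close> is split twice: over \<open>A\<close> and its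
    complement as \<alpha> + \<beta>, and over \<open>A + \<tau>\<close> and its complement as
    \<gamma> + \<delta>. Translation shows that \<open>v1\<close> has energy \<gamma> + \<beta> and
    \<open>v2\<close> has energy \<alpha> + \<delta>: the shares of \<open>A\<close> and
    \<open>A + \<tau>\<close> are swapped.\<close>
  define \<alpha> where "\<alpha> = (\<integral>\<^sup>+x. indicator A x * G x \<partial>lborel)"
  define \<beta> where "\<beta> = (\<integral>\<^sup>+x. indicator (- A) x * G x \<partial>lborel)"
  define \<gamma> where "\<gamma> = (\<integral>\<^sup>+x. indicator A (x - \<tau>) * G x \<partial>lborel)"
  define \<delta> where "\<delta> = (\<integral>\<^sup>+x. indicator (- A) (x - \<tau>) * G x \<partial>lborel)"
  have "(\<integral>\<^sup>+x. G_energy a \<sigma> (grad u x) * indicator \<Omega> x \<partial>lborel) = (\<integral>\<^sup>+x. G x \<partial>lborel)"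
    using uD by (intro nn_integral_cong_AE, eventually_elim) (auto simp: G_def indicator_def)
  then have Eu: "?E u = (\<integral>\<^sup>+x. G x \<partial>lborel)" by (simp add: nn_integral_lebesgue_on[OF op])
  have "(\<integral>\<^sup>+x. G x \<partial>lborel) = (\<integral>\<^sup>+x. indicator A x * G x + indicator (- A) x * G x \<partial>lborel)"
    by (intro nn_integral_cong) (auto simp: indicator_def)
  also have "\<dots> = \<alpha> + \<beta>" unfolding \<alpha>_def \<beta>_def by (rule nn_integral_add) measurable
  finally have Eu1: "?E u = \<alpha> + \<beta>" using Eu by simp
  have "(\<integral>\<^sup>+x. G x \<partial>lborel) = (\<integral>\<^sup>+x. indicator A (x - \<tau>) * G x + indicator (- A) (x - \<tau>) * G x \<partial>lborel)"
    by (intro nn_integral_cong) (auto simp: indicator_def)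
  also have "\<dots> = \<gamma> + \<delta>" unfolding \<gamma>_def \<delta>_def by (rule nn_integral_add) measurable
  finally have Eu2: "?E u = \<gamma> + \<delta>" using Eu by simp
  have "?E v1 = (\<integral>\<^sup>+x. G_energy a \<sigma> (grad v1 x) * indicator \<Omega> x \<partial>lborel)"
    by (rule nn_integral_lebesgue_on[OF op])
  also have "\<dots> = (\<integral>\<^sup>+x. indicator A x * G (x + \<tau>) + indicator (- A) x * G x \<partial>lborel)"
    using g1 uD AE_lborel_translate[OF uD, of \<tau>]
    by (intro nn_integral_cong_AE, eventually_elim) (use A_sub in \<open>auto simp: G_def indicator_def\<close>)
  also have "\<dots> = (\<integral>\<^sup>+x. indicator A x * G (x + \<tau>) \<partial>lborel) + \<beta>"
    unfolding \<beta>_def by (rule nn_integral_add) measurable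
  finally have Ev1: "?E v1 = (\<integral>\<^sup>+x. indicator A x * G (x + \<tau>) \<partial>lborel) + \<beta>" .
  have shift1: "(\<integral>\<^sup>+x. indicator A x * G (x + \<tau>) \<partial>lborel) = \<gamma>"
    using nn_integral_lborel_translate[of "\<lambda>x. indicator A (x - \<tau>) * G x" \<tau>] by (simp add: \<gamma>_def)
  have "?E v2 = (\<integral>\<^sup>+x. G_energy a \<sigma> (grad v2 x) * indicator \<Omega> x \<partial>lborel)"
    by (rule nn_integral_lebesgue_on[OF op])
  also have "\<dots> = (\<integral>\<^sup>+x. indicator A (x - \<tau>) * G (x - \<tau>) + indicator (- A) (x - \<tau>) * G x \<partial>lborel)"
    using g2 uD AE_lborel_translate[OF uD, of "- \<tau>"]
    by (intro nn_integral_cong_AE, eventually_elim) (use A_sub in \<open>force simp: G_def indicator_def\<close>)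
  also have "\<dots> = (\<integral>\<^sup>+x. indicator A (x - \<tau>) * G (x - \<tau>) \<partial>lborel) + \<delta>"
    unfolding \<delta>_def by (rule nn_integral_add) measurable
  finally have Ev2: "?E v2 = (\<integral>\<^sup>+x. indicator A (x - \<tau>) * G (x - \<tau>) \<partial>lborel) + \<delta>" .
  have shift2: "(\<integral>\<^sup>+x. indicator A (x - \<tau>) * G (x - \<tau>) \<partial>lborel) = \<alpha>"
    using nn_integral_lborel_translate[of "\<lambda>x. indicator A x * G x" "- \<tau>"] by (simp add: \<alpha>_def)
  obtain e where e: "e \<ge> 0" "?E u = ennreal e" using F_energy_finite[OF fin] .
  have fin4: "\<alpha> \<noteq> \<infinity>" "\<beta> \<noteq> \<infinity>" "\<gamma> \<noteq> \<infinity>" "\<delta> \<noteq> \<infinity>"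
    using Eu1 Eu2 e by auto
  obtain ra where ra: "ra \<ge> 0" "\<alpha> = ennreal ra" using fin4(1) by (cases \<alpha>) auto
  obtain rb where rb: "rb \<ge> 0" "\<beta> = ennreal rb" using fin4(2) by (cases \<beta>) auto
  obtain rc where rc: "rc \<ge> 0" "\<gamma> = ennreal rc" using fin4(3) by (cases \<gamma>) auto
  obtain rd where rd: "rd \<ge> 0" "\<delta> = ennreal rd" using fin4(4) by (cases \<delta>) auto
  have E1: "?E u = ennreal (ra + rb)" and E2: "?E u = ennreal (rc + rd)"
    and E3: "?E v1 = ennreal (rc + rb)" and E4: "?E v2 = ennreal (ra + rd)"
    using Eu1 Eu2 Ev1[unfolded shift1] Ev2[unfolded shift2] ra rb rc rd by (simp_all add: ennreal_plus)
  have "ennreal (ra + rb) = ennreal (rc + rd)" using E1 E2 by (simp only:)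
  then have sum: "ra + rb = rc + rd" using ra rb rc rd by (subst (asm) ennreal_inj) auto
  define I where "I v = (\<integral>x. lam * v x \<partial>lebesgue_on \<Omega>)" for v
  have Fu: "?F u = ereal (ra + rb - I u)" and Fv1: "?F v1 = ereal (rc + rb - I v1)"
    and Fv2: "?F v2 = ereal (ra + rd - I v2)"
    using F_energy_real[OF E1] F_energy_real[OF E3] F_energy_real[OF E4] ra rb rc rd by (simp_all add: I_def)
  have intg: "integrable (lebesgue_on \<Omega>) u" "integrable (lebesgue_on \<Omega>) w" "integrable (lebesgue_on \<Omega>) wt"
    using Lipschitz_integrable[OF bd op C'] Lipschitz_integrable[OF bd op lipschitz_on_subset[OF wlip]]
      Lipschitz_integrable[OF bd op lipschitz_on_subset[OF wtlip]] by auto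
  have whole: "(\<integral>x. f x \<partial>lebesgue_on \<Omega>) = (\<integral>x. f x \<partial>lborel)"
    if "f \<in> borel_measurable borel" "\<And>x. x \<notin> \<Omega> \<Longrightarrow> f x = 0" for f :: "'a \<Rightarrow> real"
  proof -
    have "(\<integral>x. f x \<partial>lebesgue_on \<Omega>) = (\<integral>x. indicator \<Omega> x *\<^sub>R f x \<partial>lebesgue)"
      by (rule integral_restrict_space) (use op in auto)
    also have "\<dots> = (\<integral>x. f x \<partial>lebesgue)"
      by (rule Bochner_Integration.integral_cong) (use that(2) in \<open>auto simp: indicator_def\<close>)
    also have "\<dots> = (\<integral>x. f x \<partial>lborel)"
      using that(1) by (intro integral_completion) simp
    finally show ?thesis .
  qed
  \<comment> \<open>Both \<open>w\<close> and its translate vanish outside \<Omega>, so their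
    integrals over \<Omega> are integrals over the whole space and agree. A constant load therefore
    does the same work on the two perturbations.\<close>
  have "(\<integral>x. wt x \<partial>lebesgue_on \<Omega>) = (\<integral>x. wt x \<partial>lborel)"
    by (rule whole) (use wout in \<open>auto simp: wt_def[abs_def]\<close>)
  also have "\<dots> = (\<integral>x. w x \<partial>lborel)"
    using integral_lborel_translate[of w "- \<tau>"] by (simp add: wt_def)
  also have "\<dots> = (\<integral>x. w x \<partial>lebesgue_on \<Omega>)"
    by (rule whole[symmetric]) (use wout in auto)
  finally have iw: "(\<integral>x. wt x \<partial>lebesgue_on \<Omega>) = (\<integral>x. w x \<partial>lebesgue_on \<Omega>)" .
  have "I v1 = I u + lam * (\<integral>x. w x \<partial>lebesgue_on \<Omega>)" "I v2 = I u - lam * (\<integral>x. wt x \<partial>lebesgue_on \<Omega>)"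
    using intg by (simp_all add: I_def v1_def v2_def distrib_left right_diff_distrib)
  then have "I v1 + I v2 = 2 * I u" using iw by simp
  moreover have "?F u \<le> ?F v1" "?F u \<le> ?F v2"
    using min v1a v2a by (auto simp: is_minimizer_def)
  \<comment> \<open>The two energies average to that of \<open>u\<close> and neither lies below it,
    so each equals it.\<close>
  ultimately have "?F v1 = ?F u" using sum Fu Fv1 Fv2 by auto
  then have "is_minimizer a \<sigma> \<Omega> (\<lambda>_. lam) g v1"
    using min v1a by (auto simp: is_minimizer_def)
  then have "u z = v1 z"
    by (rule minimizer_unique[OF op bd _ a2 min _ fin z(1), rotated]) (rule a)
  then have "w z = 0" by (simp add: v1_def)
  then show ?thesis using z by (auto simp: w_def O'_def w'_def max_def split: if_splits)
qed

section \<open>The Euler-Lagrange equation\<close>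

text \<open>The tangent line of a convex power. In the induction, multiplying by \<open>A\<close>
  leaves a multiple of the square (A - B)^2 to spare.\<close>

lemma power_tangent_le:
  fixes A B :: real
  assumes "A \<ge> 0" "B \<ge> 0"
  shows "B ^ Suc n + real (Suc n) * B ^ n * (A - B) \<le> A ^ Suc n"
proof (induction n)
  case (Suc n)
  have "A * (B ^ Suc n + real (Suc n) * B ^ n * (A - B)) \<le> A * A ^ Suc n"
    using Suc assms by (intro mult_left_mono) auto
  moreover have "A * (B ^ Suc n + real (Suc n) * B ^ n * (A - B)) =
      B ^ Suc (Suc n) + real (Suc (Suc n)) * B ^ Suc n * (A - B) + real (Suc n) * B ^ n * (A - B)\<^sup>2"
    by (simp add: algebra_simps power2_eq_square)
  moreover have "0 \<le> real (Suc n) * B ^ n * (A - B)\<^sup>2" using assms by simp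
  ultimately show ?case by simp
qed simp

text \<open>The mean value bound multiplied by \<open>R\<close>, so that the exponent is
  \<open>n\<close> and the case n = 0 needs no truncated subtraction.\<close>

lemma power_diff_le:
  fixes x y R :: real
  assumes "0 \<le> x" "x \<le> R" "0 \<le> y" "y \<le> R"
  shows "\<bar>x ^ n - y ^ n\<bar> * R \<le> real n * R ^ n * \<bar>x - y\<bar>"
proof (cases n)
  case (Suc m)
  have 1: "v ^ Suc m - w ^ Suc m \<le> real (Suc m) * R ^ m * \<bar>v - w\<bar>"
    if "0 \<le> v" "v \<le> R" "0 \<le> w" for v w
  proof -
    have "v ^ Suc m - w ^ Suc m \<le> real (Suc m) * v ^ m * (v - w)"
      using power_tangent_le[OF that(3,1), of m] by (simp add: algebra_simps)
    also have "\<dots> \<le> real (Suc m) * v ^ m * \<bar>v - w\<bar>" using that by (intro mult_left_mono) auto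
    also have "\<dots> \<le> real (Suc m) * R ^ m * \<bar>v - w\<bar>"
      using that by (intro mult_right_mono mult_left_mono power_mono) auto
    finally show ?thesis .
  qed
  have "\<bar>x ^ Suc m - y ^ Suc m\<bar> \<le> real (Suc m) * R ^ m * \<bar>x - y\<bar>"
    using 1[of x y] 1[of y x] assms by (simp add: abs_le_iff abs_minus_commute)
  then have "\<bar>x ^ Suc m - y ^ Suc m\<bar> * R \<le> real (Suc m) * R ^ m * \<bar>x - y\<bar> * R"
    using assms by (intro mult_right_mono) auto
  also have "\<dots> = real (Suc m) * R ^ Suc m * \<bar>x - y\<bar>" by (simp add: mult_ac)
  finally show ?thesis using Suc by simp
qed simp

text \<open>Convexity bounds the increment by the slope at the new point \<zeta>. Passing to the
  slope at \<xi> costs two quadratic terms: weight 1 from the inner product and weight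
  \<open>p\<close> from the difference of the powers, hence \<open>p + 1\<close>.\<close>

lemma norm_power_expansion:
  fixes \<xi> \<zeta> :: "'a::real_inner"
  assumes R: "norm \<xi> \<le> R" "norm \<zeta> \<le> R"
  shows "norm \<zeta> ^ (p + 2) / real (p + 2) \<le> norm \<xi> ^ (p + 2) / real (p + 2)
    + norm \<xi> ^ p * (\<xi> \<bullet> (\<zeta> - \<xi>)) + real (p + 1) * R ^ p * (norm (\<zeta> - \<xi>))\<^sup>2"
proof -
  define A B d where "A = norm \<xi>" and "B = norm \<zeta>" and "d = norm (\<zeta> - \<xi>)"
  have AB: "0 \<le> A" "A \<le> R" "0 \<le> B" "B \<le> R" "0 \<le> d" using R by (auto simp: A_def B_def d_def)
  have "B ^ (p + 2) + real (p + 2) * B ^ (p + 1) * (A - B) \<le> A ^ (p + 2)"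
    using power_tangent_le[of A B "p + 1"] AB by simp
  then have "(B ^ (p + 2) - A ^ (p + 2)) \<le> real (p + 2) * (B ^ (p + 1) * (B - A))"
    by (simp add: algebra_simps)
  then have 1: "B ^ (p + 2) / real (p + 2) - A ^ (p + 2) / real (p + 2) \<le> B ^ (p + 1) * (B - A)"
    by (simp add: diff_divide_distrib[symmetric] pos_divide_le_eq mult.commute)
  have "\<zeta> \<bullet> \<xi> \<le> B * A" unfolding A_def B_def by (rule norm_cauchy_schwarz)
  then have "B ^ p * (\<zeta> \<bullet> \<xi>) \<le> B ^ p * (B * A)" using AB by (intro mult_left_mono) auto
  moreover have "\<zeta> \<bullet> \<zeta> = B * B" by (simp add: B_def dot_square_norm power2_eq_square)
  ultimately have 2: "B ^ (p + 1) * (B - A) \<le> B ^ p * (\<zeta> \<bullet> (\<zeta> - \<xi>))"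
    by (simp add: inner_diff_right algebra_simps)
  have "B ^ p * (\<zeta> \<bullet> (\<zeta> - \<xi>)) - A ^ p * (\<xi> \<bullet> (\<zeta> - \<xi>)) =
      B ^ p * d\<^sup>2 + (B ^ p - A ^ p) * (\<xi> \<bullet> (\<zeta> - \<xi>))"
    by (simp add: d_def power2_norm_eq_inner inner_diff_left inner_diff_right algebra_simps inner_commute)
  moreover have "B ^ p * d\<^sup>2 \<le> R ^ p * d\<^sup>2" using AB by (intro mult_right_mono power_mono) auto
  moreover have "(B ^ p - A ^ p) * (\<xi> \<bullet> (\<zeta> - \<xi>)) \<le> real p * R ^ p * d\<^sup>2"
  proof -
    have "(B ^ p - A ^ p) * (\<xi> \<bullet> (\<zeta> - \<xi>)) \<le> \<bar>B ^ p - A ^ p\<bar> * \<bar>\<xi> \<bullet> (\<zeta> - \<xi>)\<bar>"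
      by (metis abs_ge_self abs_mult)
    also have "\<dots> \<le> \<bar>B ^ p - A ^ p\<bar> * (R * d)"
    proof (intro mult_left_mono)
      have "\<bar>\<xi> \<bullet> (\<zeta> - \<xi>)\<bar> \<le> A * d" unfolding A_def d_def by (rule Cauchy_Schwarz_ineq2)
      also have "\<dots> \<le> R * d" using AB by (intro mult_right_mono) auto
      finally show "\<bar>\<xi> \<bullet> (\<zeta> - \<xi>)\<bar> \<le> R * d" .
    qed simp
    also have "\<dots> = (\<bar>B ^ p - A ^ p\<bar> * R) * d" by simp
    also have "\<dots> \<le> (real p * R ^ p * \<bar>B - A\<bar>) * d"
      using power_diff_le[of B R A p] AB by (intro mult_right_mono) auto
    also have "\<dots> \<le> (real p * R ^ p * d) * d"
      using AB order_trans[OF AB(1,2)] norm_triangle_ineq3[of \<zeta> \<xi>]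
      by (intro mult_right_mono mult_left_mono) (auto simp: A_def B_def d_def)
    finally show ?thesis by (simp add: power2_eq_square mult.assoc)
  qed
  ultimately have "B ^ p * (\<zeta> \<bullet> (\<zeta> - \<xi>)) \<le> A ^ p * (\<xi> \<bullet> (\<zeta> - \<xi>)) + real (p + 1) * R ^ p * d\<^sup>2"
    by (simp add: algebra_simps)
  with 1 2 show ?thesis unfolding A_def[symmetric] B_def[symmetric] d_def[symmetric] by linarith
qed

text \<open>The hypothesis says that \<sigma> is the radius of convergence. Differentiating
  termwise, dropping the first term and dividing by \<open>R\<close> gives this series, the majorant
  for the quadratic remainders.\<close>

lemma coefficients_summable:
  fixes a :: "nat \<Rightarrow> real"
  assumes a: "\<And>p. p \<ge> 2 \<Longrightarrow> a p \<ge> 0" and lim: "limsup (\<lambda>p. ereal (root p (a p))) = ereal (1 / \<sigma>)"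
    and R: "0 < R" "R < \<sigma>"
  shows "summable (\<lambda>p. real (p + 2) * a (p + 2) * R ^ p)"
proof -
  \<comment> \<open>Only from index 2 on are the coefficients known to be nonnegative; the limsup
    ignores the first two.\<close>
  have "limsup (\<lambda>n. ereal (root n (norm (a n)))) = limsup (\<lambda>p. ereal (root p (a p)))"
    by (rule Limsup_eq) (use a in \<open>auto simp: eventually_sequentially intro!: exI[of _ 2]\<close>)
  then have cr: "conv_radius a = ereal \<sigma>" using R by (simp add: conv_radius_def lim)
  have "summable (\<lambda>n. diffs a n * R ^ n)"
  proof (rule termdiff_converges)
    show "norm R < \<sigma>" using R by simp
    show "summable (\<lambda>n. a n * x ^ n)" if "norm x < \<sigma>" for x
      by (rule summable_in_conv_radius) (use that cr in simp)
  qed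
  then have "summable (\<lambda>n. diffs a (Suc n) * R ^ Suc n)" by (subst summable_Suc_iff)
  then have "summable (\<lambda>n. (1 / R) * (diffs a (Suc n) * R ^ Suc n))" by (rule summable_mult)
  then show ?thesis using R by (simp add: diffs_def mult.assoc)
qed

lemma integrable_bounded_on:
  fixes f :: "'a::euclidean_space \<Rightarrow> real"
  assumes "bounded \<Omega>" "open \<Omega>" "f \<in> borel_measurable (lebesgue_on \<Omega>)" "\<And>x. x \<in> \<Omega> \<Longrightarrow> \<bar>f x\<bar> \<le> B"
  shows "integrable (lebesgue_on \<Omega>) f"
proof -
  have "\<Omega> \<in> lmeasurable" using assms by (intro bounded_set_imp_lmeasurable) auto
  then interpret finite_measure "lebesgue_on \<Omega>" by (rule finite_measure_lebesgue_on)
  show ?thesis using assms by (intro integrable_const_bound[where B = B]) (auto intro!: AE_I2)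
qed

text \<open>All slopes are at most \<sigma>, so the infinite branch of \<open>G_energy\<close> never
  occurs and the nonnegative series may be integrated termwise. The sum is still allowed to be
  infinite.\<close>

lemma energy_eq_suminf:
  fixes v :: "'a::euclidean_space \<Rightarrow> real"
  assumes op: "open \<Omega>" and bd: "bounded \<Omega>" and a: "\<And>p. p \<ge> 2 \<Longrightarrow> a p \<ge> 0"
    and v: "R-lipschitz_on \<Omega> v" and R: "R \<le> \<sigma>"
  shows "(\<integral>\<^sup>+x. G_energy a \<sigma> (grad v x) \<partial>lebesgue_on \<Omega>) =
    (\<Sum>p. ennreal (a (p + 2) * ((\<integral>x. norm (grad v x) ^ (p + 2) \<partial>lebesgue_on \<Omega>) / real (p + 2))))"
proof -
  note [measurable] = grad_measurable[OF op v]
  have gr: "norm (grad v x) \<le> R" if "x \<in> \<Omega>" for x by (rule Lipschitz_norm_grad_le[OF op v that])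
  have "(\<integral>\<^sup>+x. G_energy a \<sigma> (grad v x) \<partial>lebesgue_on \<Omega>) =
      (\<integral>\<^sup>+x. (\<Sum>p. ennreal (a (p + 2) / real (p + 2) * norm (grad v x) ^ (p + 2))) \<partial>lebesgue_on \<Omega>)"
  proof (rule nn_integral_cong)
    fix x assume "x \<in> space (lebesgue_on \<Omega>)"
    then have "norm (grad v x) \<le> \<sigma>" using gr[of x] R by simp
    then show "G_energy a \<sigma> (grad v x) = (\<Sum>p. ennreal (a (p + 2) / real (p + 2) * norm (grad v x) ^ (p + 2)))"
      by (simp only: G_energy_def Phi_def if_True)
  qed
  also have "\<dots> = (\<Sum>p. \<integral>\<^sup>+x. ennreal (a (p + 2) / real (p + 2) * norm (grad v x) ^ (p + 2)) \<partial>lebesgue_on \<Omega>)"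
    by (rule nn_integral_suminf) measurable
  also have "\<dots> = (\<Sum>p. ennreal (a (p + 2) * ((\<integral>x. norm (grad v x) ^ (p + 2) \<partial>lebesgue_on \<Omega>) / real (p + 2))))"
  proof (rule suminf_cong)
    fix p
    have i: "integrable (lebesgue_on \<Omega>) (\<lambda>x. norm (grad v x) ^ (p + 2))"
      by (rule integrable_bounded_on[OF bd op, where B = "R ^ (p + 2)"])
        (measurable, use gr in \<open>auto intro!: power_mono simp del: power_Suc\<close>)
    have "(\<integral>\<^sup>+x. ennreal (a (p + 2) / real (p + 2) * norm (grad v x) ^ (p + 2)) \<partial>lebesgue_on \<Omega>)
       = ennreal (\<integral>x. a (p + 2) / real (p + 2) * norm (grad v x) ^ (p + 2) \<partial>lebesgue_on \<Omega>)"
      by (rule nn_integral_eq_integral) (use i a[of "p + 2"] in auto)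
    also have "(\<integral>x. a (p + 2) / real (p + 2) * norm (grad v x) ^ (p + 2) \<partial>lebesgue_on \<Omega>)
       = a (p + 2) * ((\<integral>x. norm (grad v x) ^ (p + 2) \<partial>lebesgue_on \<Omega>) / real (p + 2))"
      by simp
    finally show "(\<integral>\<^sup>+x. ennreal (a (p + 2) / real (p + 2) * norm (grad v x) ^ (p + 2)) \<partial>lebesgue_on \<Omega>)
       = ennreal (a (p + 2) * ((\<integral>x. norm (grad v x) ^ (p + 2) \<partial>lebesgue_on \<Omega>) / real (p + 2)))" .
  qed
  finally show ?thesis .
qed

lemma zero_if_quadratic_nonneg:
  fixes X Q t0 :: real
  assumes t0: "t0 > 0" and ge: "\<And>t. \<bar>t\<bar> \<le> t0 \<Longrightarrow> 0 \<le> t * X + t\<^sup>2 * Q"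
  shows "X = 0"
proof (rule ccontr)
  assume X: "X \<noteq> 0"
  \<comment> \<open>So small that the quadratic term is at most half of |X| t, hence too weak to
    offset the linear term at \<open>- sgn X * t\<close>. Adding 1 to |Q| avoids a zero
    denominator.\<close>
  define t where "t = min t0 (\<bar>X\<bar> / (2 * (\<bar>Q\<bar> + 1)))"
  have t: "0 < t" "t \<le> t0" "t \<le> \<bar>X\<bar> / (2 * (\<bar>Q\<bar> + 1))" using t0 X by (auto simp: t_def)
  have "0 \<le> (- sgn X * t) * X + (- sgn X * t)\<^sup>2 * Q"
    by (rule ge) (use t X in \<open>simp add: abs_mult abs_sgn_eq\<close>)
  also have "(- sgn X * t) * X + (- sgn X * t)\<^sup>2 * Q = t * (t * Q - \<bar>X\<bar>)"
    using X by (simp add: sgn_if power2_eq_square algebra_simps)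
  finally have "\<bar>X\<bar> \<le> t * Q" using t(1) by (simp add: zero_le_mult_iff)
  also have "\<dots> \<le> t * (\<bar>Q\<bar> + 1)" using t(1) by (intro mult_left_mono) auto
  also have "\<dots> \<le> \<bar>X\<bar> / 2"
  proof -
    have "t * (2 * (\<bar>Q\<bar> + 1)) \<le> \<bar>X\<bar>" using t(3) by (subst (asm) pos_le_divide_eq) auto
    then show ?thesis by (simp add: algebra_simps)
  qed
  finally show False using X by simp
qed

text \<open>Testing minimality with \<open>u + t \<psi>\<close> for both signs of a small \<open>t\<close>; the second order
  remainder is summable because all the slopes stay below some \<open>R < \<sigma>\<close>.\<close>

proposition minimizer_weak_solution:
  fixes u :: "'a::euclidean_space \<Rightarrow> real"
  assumes op: "open \<Omega>" and bd: "bounded \<Omega>" and a: "\<And>p. p \<ge> 2 \<Longrightarrow> a p \<ge> 0"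
    and lim: "limsup (\<lambda>p. ereal (root p (a p))) = ereal (1 / \<sigma>)"
    and min: "is_minimizer a \<sigma> \<Omega> (\<lambda>_. lam) g u"
    and s: "s-lipschitz_on \<Omega> u" "s < \<sigma>"
  shows "weak_solution a \<sigma> \<Omega> (\<lambda>_. lam) g u"
  unfolding weak_solution_def
proof (intro conjI allI impI)
  show ua: "u \<in> admissible \<Omega> \<sigma> g" using min by (simp add: is_minimizer_def)
  fix \<psi> :: "'a \<Rightarrow> real"
  assume "lipschitz_fun (closure \<Omega>) \<psi>" and \<psi>0: "\<forall>x\<in>frontier \<Omega>. \<psi> x = 0"
    and P_sum: "summable (\<lambda>p. a (p + 2) * \<bar>p_form (p + 2) \<Omega> u \<psi>\<bar>)"
  then obtain K where K: "K-lipschitz_on (closure \<Omega>) \<psi>" by (auto simp: lipschitz_fun_def)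
  have K': "K-lipschitz_on \<Omega> \<psi>" using K closure_subset by (rule lipschitz_on_subset)
  have K0: "K \<ge> 0" and s0: "s \<ge> 0" using K s by (auto dest: lipschitz_on_nonneg)
  \<comment> \<open>\<open>R\<close> lies halfway between \<open>s\<close> and \<sigma>, and
    \<open>t0\<close> is chosen so that \<open>u + t \<psi>\<close> has slope at most
    \<open>R\<close> for |t| \<le> \<open>t0\<close>; \<open>K + 1\<close> replaces \<open>K\<close>
    because \<open>K\<close> may be 0.\<close>
  define R where "R = (s + \<sigma>) / 2"
  define t0 where "t0 = ((\<sigma> - s) / 2) / (K + 1)"
  have R: "0 < R" "R < \<sigma>" "s \<le> R" using s0 s(2) by (auto simp: R_def)
  have t0: "t0 > 0" using s(2) K0 by (simp add: t0_def)
  have tR: "s + \<bar>t\<bar> * K \<le> R" if "\<bar>t\<bar> \<le> t0" for t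
  proof -
    have "\<bar>t\<bar> * K \<le> t0 * (K + 1)" using that K0 t0 by (intro mult_mono) auto
    also have "\<dots> = (\<sigma> - s) / 2"
      using nonzero_eq_divide_eq[of "K + 1" t0 "(\<sigma> - s) / 2"] K0 by (simp only: t0_def) simp
    finally show ?thesis by (simp add: R_def field_simps)
  qed
  define m where "m = measure lebesgue \<Omega>"
  have lm: "\<Omega> \<in> lmeasurable" using op bd by (intro bounded_set_imp_lmeasurable) auto
  define J where "J v p = (\<integral>x. norm (grad v x) ^ (p + 2) \<partial>lebesgue_on \<Omega>) / real (p + 2)" for v :: "'a \<Rightarrow> real" and p
  \<comment> \<open>The sum of \<open>P\<close> is the left side of the weak equation.
    \<open>Q\<close> bounds the quadratic remainders: \<open>K\<close> controls the gradient of
    \<psi>, \<open>R\<close> those of \<open>u\<close> and of the competitor, and \<open>m\<close>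
    is the measure of \<Omega>.\<close>
  define P where "P p = a (p + 2) * p_form (p + 2) \<Omega> u \<psi>" for p
  define Q where "Q p = a (p + 2) * (real (p + 1) * R ^ p * (K\<^sup>2 * m))" for p
  have a': "a (p + 2) \<ge> 0" for p using a by simp
  have J0: "J v p \<ge> 0" for v p unfolding J_def
    by (intro divide_nonneg_nonneg Bochner_Integration.integral_nonneg) auto
  have Rsum: "summable (\<lambda>p. real (p + 2) * a (p + 2) * R ^ p)"
    using a by (rule coefficients_summable[OF _ lim R(1,2)])
  have const_int: "(\<integral>x. c \<partial>lebesgue_on \<Omega>) = c * m" for c :: real
    using lm by (simp add: m_def measure_restrict_space)
  have const_i: "integrable (lebesgue_on \<Omega>) (\<lambda>x. c)" for c :: real
    by (rule integrable_bounded_on[OF bd op, where B = "\<bar>c\<bar>"]) auto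
  have Qsum: "summable Q"
  proof (rule summable_comparison_test'[where N = 0])
    show "summable (\<lambda>p. (K\<^sup>2 * m) * (real (p + 2) * a (p + 2) * R ^ p))" using Rsum by (rule summable_mult)
    fix p
    have "0 \<le> Q p" using a'[of p] R by (simp add: Q_def m_def)
    moreover have "Q p \<le> (K\<^sup>2 * m) * (real (p + 2) * a (p + 2) * R ^ p)"
    proof -
      have "(K\<^sup>2 * m * (a (p + 2) * R ^ p)) * real (p + 1) \<le> (K\<^sup>2 * m * (a (p + 2) * R ^ p)) * real (p + 2)"
        using a'[of p] R by (intro mult_left_mono) (auto simp: m_def)
      then show ?thesis by (simp only: Q_def mult_ac)
    qed
    ultimately show "norm (Q p) \<le> (K\<^sup>2 * m) * (real (p + 2) * a (p + 2) * R ^ p)" by simp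
  qed
  have Psum: "summable P"
    using P_sum by (intro summable_norm_cancel[of P]) (use a' in \<open>simp add: P_def abs_mult\<close>)
  have gm: "grad v \<in> borel_measurable (lebesgue_on \<Omega>)" if "C-lipschitz_on \<Omega> v" for C and v :: "'a \<Rightarrow> real"
    using op that by (rule grad_measurable)
  have Jint: "integrable (lebesgue_on \<Omega>) (\<lambda>x. norm (grad v x) ^ (p + 2))" if v: "C-lipschitz_on \<Omega> v" for C v p
  proof (rule integrable_bounded_on[OF bd op, where B = "C ^ (p + 2)"])
    show "(\<lambda>x. norm (grad v x) ^ (p + 2)) \<in> borel_measurable (lebesgue_on \<Omega>)" using gm[OF v] by measurable
    show "\<bar>norm (grad v x) ^ (p + 2)\<bar> \<le> C ^ (p + 2)" if "x \<in> \<Omega>" for x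
      using Lipschitz_norm_grad_le[OF op v that] by (simp del: power_Suc add: power_mono)
  qed
  have Jsum: "summable (\<lambda>p. a (p + 2) * J u p)"
  proof (rule summable_comparison_test'[where N = 0])
    show "summable (\<lambda>p. (R\<^sup>2 * m) * (real (p + 2) * a (p + 2) * R ^ p))" using Rsum by (rule summable_mult)
    fix p
    have "(\<integral>x. norm (grad u x) ^ (p + 2) \<partial>lebesgue_on \<Omega>) \<le> (\<integral>x. R ^ (p + 2) \<partial>lebesgue_on \<Omega>)"
    proof (intro integral_mono Jint[OF s(1)] const_i)
      fix x assume "x \<in> space (lebesgue_on \<Omega>)"
      then show "norm (grad u x) ^ (p + 2) \<le> R ^ (p + 2)"
        using Lipschitz_norm_grad_le[OF op s(1), of x] R by (intro power_mono) auto
    qed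
    then have "J u p \<le> R ^ (p + 2) * m / real (p + 2)"
      unfolding J_def const_int by (intro divide_right_mono) auto
    also have "\<dots> \<le> R ^ (p + 2) * m * real (p + 2)"
      unfolding divide_inverse using R by (intro mult_left_mono) (auto simp: m_def field_simps)
    finally have "a (p + 2) * J u p \<le> a (p + 2) * (R ^ (p + 2) * m * real (p + 2))"
      using a'[of p] by (intro mult_left_mono)
    then show "norm (a (p + 2) * J u p) \<le> (R\<^sup>2 * m) * (real (p + 2) * a (p + 2) * R ^ p)"
      using a'[of p] J0[of u p] by (simp add: power_add power2_eq_square mult_ac)
  qed
  have Eu: "(\<integral>\<^sup>+x. G_energy a \<sigma> (grad u x) \<partial>lebesgue_on \<Omega>) = ennreal (\<Sum>p. a (p + 2) * J u p)"
  proof -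
    have "(\<integral>\<^sup>+x. G_energy a \<sigma> (grad u x) \<partial>lebesgue_on \<Omega>) = (\<Sum>p. ennreal (a (p + 2) * J u p))"
      unfolding J_def using s by (intro energy_eq_suminf[OF op bd _ s(1)] a) auto
    also have "\<dots> = ennreal (\<Sum>p. a (p + 2) * J u p)"
      using a' J0 by (intro suminf_ennreal2 Jsum) simp
    finally show ?thesis .
  qed
  have iu: "integrable (lebesgue_on \<Omega>) u" "integrable (lebesgue_on \<Omega>) \<psi>"
    using Lipschitz_integrable[OF bd op s(1)] Lipschitz_integrable[OF bd op K'] by auto
  define \<Lambda> where "\<Lambda> = (\<integral>x. lam * \<psi> x \<partial>lebesgue_on \<Omega>)"
  have "0 \<le> t * (suminf P - \<Lambda>) + t\<^sup>2 * suminf Q" if t: "\<bar>t\<bar> \<le> t0" for t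
  proof -
    define v where "v x = u x + t * \<psi> x" for x
    have vl: "R-lipschitz_on \<Omega> v"
    proof (rule lipschitz_on_mono[OF _ order_refl tR[OF t]])
      show "(s + \<bar>t\<bar> * K)-lipschitz_on \<Omega> v"
        unfolding v_def by (intro lipschitz_on_add lipschitz_on_cmult_real s K')
    qed
    have va: "v \<in> admissible \<Omega> \<sigma> g"
      unfolding v_def[abs_def]
    proof (rule admissible_perturbation[OF op ua K])
      show "\<psi> x = 0" if "x \<in> frontier \<Omega>" for x using \<psi>0 that by blast
      show "AE x in lborel. x \<in> \<Omega> \<longrightarrow> norm (grad (\<lambda>x. u x + t * \<psi> x) x) \<le> \<sigma>"
        using Lipschitz_norm_grad_le[OF op vl] R(2) unfolding v_def[abs_def] by (intro AE_I2) force
    qed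
    have gv: "AE x in lebesgue_on \<Omega>. grad v x = grad u x + t *\<^sub>R grad \<psi> x"
      unfolding AE_lebesgue_on_iff[OF op]
      using Lipschitz_AE_GDERIV[OF op s(1)] Lipschitz_AE_GDERIV[OF op K']
    proof eventually_elim
      case (elim x)
      show ?case
      proof
        assume "x \<in> \<Omega>"
        then have "(v has_derivative (\<lambda>h. h \<bullet> grad u x + t * (h \<bullet> grad \<psi> x))) (at x)"
          unfolding v_def[abs_def] using elim unfolding gderiv_def
          by (intro has_derivative_add has_derivative_mult_right) auto
        then show "grad v x = grad u x + t *\<^sub>R grad \<psi> x"
          by (intro grad_eqI) (simp add: gderiv_def inner_add_right)
      qed
    qed
    \<comment> \<open>Comparing the two energy series term by term also yields convergence of that
      of \<open>v\<close>, since the majorant is summable.\<close>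
    have termwise: "a (p + 2) * J v p \<le> a (p + 2) * J u p + t * P p + t\<^sup>2 * Q p" for p
    proof -
      let ?f = "\<lambda>x. norm (grad u x) ^ p * (grad u x \<bullet> grad \<psi> x)"
      have fi: "integrable (lebesgue_on \<Omega>) ?f"
      proof (rule integrable_bounded_on[OF bd op, where B = "s ^ p * (s * K)"])
        show "?f \<in> borel_measurable (lebesgue_on \<Omega>)" using gm[OF s(1)] gm[OF K'] by measurable
        fix x assume x: "x \<in> \<Omega>"
        have "\<bar>grad u x \<bullet> grad \<psi> x\<bar> \<le> norm (grad u x) * norm (grad \<psi> x)" by (rule Cauchy_Schwarz_ineq2)
        also have "\<dots> \<le> s * K"
          using Lipschitz_norm_grad_le[OF op s(1) x] Lipschitz_norm_grad_le[OF op K' x] s0 by (intro mult_mono) auto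
        finally show "\<bar>?f x\<bar> \<le> s ^ p * (s * K)"
          using Lipschitz_norm_grad_le[OF op s(1) x] s0 unfolding abs_mult
          by (intro mult_mono) (auto intro: power_mono)
      qed
      have "J v p = (\<integral>x. norm (grad v x) ^ (p + 2) / real (p + 2) \<partial>lebesgue_on \<Omega>)"
        unfolding J_def by simp
      also have "\<dots> \<le> (\<integral>x. norm (grad u x) ^ (p + 2) / real (p + 2) + t * ?f x + real (p + 1) * R ^ p * (t\<^sup>2 * K\<^sup>2) \<partial>lebesgue_on \<Omega>)"
      proof (rule integral_mono_AE)
        show "integrable (lebesgue_on \<Omega>) (\<lambda>x. norm (grad v x) ^ (p + 2) / real (p + 2))"
          by (rule integrable_divide_zero) (rule Jint[OF vl])
        show "integrable (lebesgue_on \<Omega>) (\<lambda>x. norm (grad u x) ^ (p + 2) / real (p + 2) + t * ?f x + real (p + 1) * R ^ p * (t\<^sup>2 * K\<^sup>2))"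
          by (intro Bochner_Integration.integrable_add integrable_divide_zero integrable_mult_right fi const_i Jint[OF s(1)])
        have "AE x in lebesgue_on \<Omega>. x \<in> \<Omega>" by (rule AE_I2) simp
        with gv show "AE x in lebesgue_on \<Omega>. norm (grad v x) ^ (p + 2) / real (p + 2) \<le>
            norm (grad u x) ^ (p + 2) / real (p + 2) + t * ?f x + real (p + 1) * R ^ p * (t\<^sup>2 * K\<^sup>2)"
        proof eventually_elim
          case (elim x)
          have n: "norm (grad u x) \<le> R" "norm (grad v x) \<le> R" "norm (grad \<psi> x) \<le> K"
            using Lipschitz_norm_grad_le[OF op s(1) elim(2)] Lipschitz_norm_grad_le[OF op vl elim(2)]
              Lipschitz_norm_grad_le[OF op K' elim(2)] R by auto
          have d: "grad v x - grad u x = t *\<^sub>R grad \<psi> x" using elim by simp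
          have "(norm (grad v x - grad u x))\<^sup>2 \<le> t\<^sup>2 * K\<^sup>2"
            unfolding d using n(3) by (simp add: power_mult_distrib mult_left_mono power_mono)
          then have "real (p + 1) * R ^ p * (norm (grad v x - grad u x))\<^sup>2 \<le> real (p + 1) * R ^ p * (t\<^sup>2 * K\<^sup>2)"
            using R by (intro mult_left_mono) auto
          moreover have "norm (grad u x) ^ p * (grad u x \<bullet> (grad v x - grad u x)) = t * ?f x"
            unfolding d by simp
          ultimately show ?case using norm_power_expansion[OF n(1,2), of p] by linarith
        qed
      qed
      also have "\<dots> = (\<integral>x. norm (grad u x) ^ (p + 2) / real (p + 2) \<partial>lebesgue_on \<Omega>) + t * (\<integral>x. ?f x \<partial>lebesgue_on \<Omega>)
          + real (p + 1) * R ^ p * (t\<^sup>2 * K\<^sup>2) * m"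
      proof -
        have i1: "integrable (lebesgue_on \<Omega>) (\<lambda>x. norm (grad u x) ^ (p + 2) / real (p + 2))"
          by (rule integrable_divide_zero) (rule Jint[OF s(1)])
        have i2: "integrable (lebesgue_on \<Omega>) (\<lambda>x. t * ?f x)" by (rule integrable_mult_right) (rule fi)
        have "(\<integral>x. t * ?f x \<partial>lebesgue_on \<Omega>) = t * (\<integral>x. ?f x \<partial>lebesgue_on \<Omega>)" by simp
        then show ?thesis
          using Bochner_Integration.integral_add[OF Bochner_Integration.integrable_add[OF i1 i2] const_i[of "real (p + 1) * R ^ p * (t\<^sup>2 * K\<^sup>2)"]]
            Bochner_Integration.integral_add[OF i1 i2] const_int[of "real (p + 1) * R ^ p * (t\<^sup>2 * K\<^sup>2)"] by linarith
      qed
      also have "(\<integral>x. norm (grad u x) ^ (p + 2) / real (p + 2) \<partial>lebesgue_on \<Omega>) = J u p" by (simp add: J_def)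
      finally have "J v p \<le> J u p + t * (\<integral>x. ?f x \<partial>lebesgue_on \<Omega>) + real (p + 1) * R ^ p * (t\<^sup>2 * K\<^sup>2) * m" .
      then have "a (p + 2) * J v p \<le> a (p + 2) * (J u p + t * (\<integral>x. ?f x \<partial>lebesgue_on \<Omega>) + real (p + 1) * R ^ p * (t\<^sup>2 * K\<^sup>2) * m)"
        using a'[of p] by (rule mult_left_mono)
      also have "\<dots> = a (p + 2) * J u p + t * P p + t\<^sup>2 * Q p"
        unfolding P_def Q_def p_form_def by (simp add: algebra_simps)
      finally show ?thesis .
    qed
    have S: "summable (\<lambda>p. a (p + 2) * J u p + t * P p + t\<^sup>2 * Q p)"
      by (intro summable_add summable_mult Jsum Psum Qsum)
    have Jv: "summable (\<lambda>p. a (p + 2) * J v p)"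
      by (rule summable_comparison_test'[OF S, of 0]) (use termwise a' J0 in simp)
    have Ev: "(\<integral>\<^sup>+x. G_energy a \<sigma> (grad v x) \<partial>lebesgue_on \<Omega>) = ennreal (\<Sum>p. a (p + 2) * J v p)"
    proof -
      have "(\<integral>\<^sup>+x. G_energy a \<sigma> (grad v x) \<partial>lebesgue_on \<Omega>) = (\<Sum>p. ennreal (a (p + 2) * J v p))"
        unfolding J_def using R by (intro energy_eq_suminf[OF op bd _ vl] a) auto
      also have "\<dots> = ennreal (\<Sum>p. a (p + 2) * J v p)"
        using a' J0 by (intro suminf_ennreal2 Jv) simp
      finally show ?thesis .
    qed
    have pos: "0 \<le> (\<Sum>p. a (p + 2) * J w p)" if "summable (\<lambda>p. a (p + 2) * J w p)" for w
      using that a' J0 by (intro suminf_nonneg) auto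
    have "F_energy a \<sigma> \<Omega> (\<lambda>_. lam) u \<le> F_energy a \<sigma> \<Omega> (\<lambda>_. lam) v"
      using min va by (simp add: is_minimizer_def)
    then have "(\<Sum>p. a (p + 2) * J u p) - (\<integral>x. lam * u x \<partial>lebesgue_on \<Omega>) \<le>
        (\<Sum>p. a (p + 2) * J v p) - (\<integral>x. lam * v x \<partial>lebesgue_on \<Omega>)"
      using F_energy_real[OF Eu pos[OF Jsum]] F_energy_real[OF Ev pos[OF Jv]] by simp
    moreover have "(\<integral>x. lam * v x \<partial>lebesgue_on \<Omega>) = (\<integral>x. lam * u x \<partial>lebesgue_on \<Omega>) + t * \<Lambda>"
      using iu by (simp add: v_def \<Lambda>_def distrib_left mult.left_commute)
    moreover have "(\<Sum>p. a (p + 2) * J v p) \<le> (\<Sum>p. a (p + 2) * J u p + t * P p + t\<^sup>2 * Q p)"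
      using termwise Jv S by (rule suminf_le)
    moreover have "(\<Sum>p. a (p + 2) * J u p + t * P p + t\<^sup>2 * Q p) =
        (\<Sum>p. a (p + 2) * J u p) + t * suminf P + t\<^sup>2 * suminf Q"
      using suminf_add[OF summable_add[OF Jsum summable_mult[OF Psum]] summable_mult[OF Qsum], of t "t\<^sup>2"]
        suminf_add[OF Jsum summable_mult[OF Psum], of t] suminf_mult[OF Psum, of t] suminf_mult[OF Qsum, of "t\<^sup>2"]
      by linarith
    ultimately show ?thesis by (simp add: right_diff_distrib)
  qed
  from zero_if_quadratic_nonneg[OF t0 this] have "suminf P = \<Lambda>" by simp
  then show "(\<Sum>p. a (p + 2) * p_form (p + 2) \<Omega> u \<psi>) = (\<integral>x. lam * \<psi> x \<partial>lebesgue_on \<Omega>)"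
    by (simp add: P_def[abs_def] \<Lambda>_def)
qed

section \<open>Equality of the two slopes\<close>

lemma slope_le_iff:
  fixes x y :: "'a::real_normed_vector"
  assumes "x \<noteq> y"
  shows "ereal (c / norm (x - y)) \<le> ereal s \<longleftrightarrow> c \<le> s * norm (x - y)"
  using assms by (simp add: pos_divide_le_eq)

theorem theorem4p4:
  fixes \<Omega> :: "'a::euclidean_space set"
    and a :: "nat \<Rightarrow> real"
    and \<sigma> lam :: real
    and g u :: "'a \<Rightarrow> real"
  assumes "open \<Omega>" and "connected \<Omega>" and "bounded \<Omega>" and "lipschitz_boundary \<Omega>"
    and "\<And>p. p \<ge> 2 \<Longrightarrow> a p \<ge> 0" and "a 2 > 0" and "infinite {p. p \<ge> 2 \<and> a p \<noteq> 0}"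
    and "\<sigma> > 0" and "limsup (\<lambda>p. ereal (root p (a p))) = ereal (1 / \<sigma>)"
    and "lipschitz_fun (frontier \<Omega>) g" and "Lip_const (frontier \<Omega>) g \<le> ereal \<sigma>"
    and "\<exists>gb\<in>admissible \<Omega> \<sigma> g. F_energy a \<sigma> \<Omega> (\<lambda>_. lam) gb < \<infinity>"
    and "is_minimizer a \<sigma> \<Omega> (\<lambda>_. lam) g u"
  shows "Lip_const \<Omega> u = boundary_slope \<Omega> g u \<and>
         (boundary_slope \<Omega> g u < ereal \<sigma> \<longrightarrow> weak_solution a \<sigma> \<Omega> (\<lambda>_. lam) g u)"
proof -
  note op = assms(1) and bd = assms(3) and a = assms(5) and min = assms(13)
  obtain gb where "gb \<in> admissible \<Omega> \<sigma> g" "F_energy a \<sigma> \<Omega> (\<lambda>_. lam) gb < \<infinity>"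
    using assms(12) by blast
  then have fin: "F_energy a \<sigma> \<Omega> (\<lambda>_. lam) u < \<infinity>"
    using min unfolding is_minimizer_def by (meson le_less_trans)
  have ua: "u \<in> admissible \<Omega> \<sigma> g" using min by (simp add: is_minimizer_def)
  then have ug: "g y = u y" if "y \<in> frontier \<Omega>" for y using that by (simp add: admissible_def)
  obtain C where C: "C-lipschitz_on (closure \<Omega>) u"
    using ua by (auto simp: admissible_def lipschitz_fun_def)
  have contu: "continuous_on (closure \<Omega>) u" using C by (rule lipschitz_on_continuous_on)
  have frO: "y \<notin> \<Omega>" "y \<in> closure \<Omega>" if "y \<in> frontier \<Omega>" for y
    using that op by (auto simp: frontier_def interior_open)
  show ?thesis
  proof (cases "\<Omega> = {}")
    case True
    \<comment> \<open>Both suprema run over the empty set and equal -\<infinity>, so the strict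
      inequality holds and the weak equation still has to be supplied.\<close>
    have "0-lipschitz_on \<Omega> u" using True by simp
    then have "weak_solution a \<sigma> \<Omega> (\<lambda>_. lam) g u"
      using minimizer_weak_solution[where a = a, OF op bd _ assms(9) min _ assms(8)] a by blast
    then show ?thesis by (simp add: Lip_const_def boundary_slope_def True)
  next
    case False
    then obtain x0 where x0: "x0 \<in> \<Omega>" by blast
    have "frontier \<Omega> \<noteq> {}"
      using False bd by (metis frontier_eq_empty not_bounded_UNIV)
    then obtain y0 where y0: "y0 \<in> frontier \<Omega>" by blast
    \<comment> \<open>A second point keeps the supremum defining \<open>Lip_const\<close> from being
      empty, hence from being -\<infinity>.\<close>
    obtain x1 where x1: "x1 \<in> \<Omega>" "x1 \<noteq> x0"
      using op x0 not_open_singleton by (metis insertI1 subsetI subset_singletonD empty_iff singletonD)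
    define S where "S = boundary_slope \<Omega> g u"
    \<comment> \<open>Arguing with real majorants \<open>s\<close> of \<open>S\<close> avoids
      arithmetic with an infinite slope: if \<open>S\<close> is \<infinity>, the upper bound is
      trivial.\<close>
    have Lip_le: "Lip_const \<Omega> u \<le> ereal s" and lip: "s-lipschitz_on \<Omega> u" if s: "S \<le> ereal s" for s
    proof -
      have 1: "\<bar>u x - u y\<bar> \<le> s * norm (x - y)" if "x \<in> \<Omega>" "y \<in> frontier \<Omega>" for x y
      proof -
        have ne: "x \<noteq> y" using that frO by auto
        have "ereal (\<bar>u x - g y\<bar> / norm (x - y)) \<le> S"
          unfolding S_def boundary_slope_def using that ne by (intro Sup_upper) blast
        then have "ereal (\<bar>u x - g y\<bar> / norm (x - y)) \<le> ereal s" using s by (rule order_trans)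
        then show ?thesis using slope_le_iff[OF ne] ug[OF that(2)] by simp
      qed
      have s0: "s \<ge> 0"
      proof -
        have "0 \<le> s * norm (x0 - y0)" using 1[OF x0 y0] by (rule order_trans[rotated]) simp
        moreover have "norm (x0 - y0) > 0" using frO y0 x0 by auto
        ultimately show ?thesis by (simp add: zero_le_mult_iff)
      qed
      \<comment> \<open>The slope bound passes to the closure by continuity. The translation bound
        needs this form, since there the other point of the pair may be on the boundary as
        well.\<close>
      have 2: "\<bar>u x - u y\<bar> \<le> s * norm (x - y)" if x: "x \<in> closure \<Omega>" and y: "y \<in> frontier \<Omega>" for x y
      proof -
        have "\<exists>X. (\<forall>n. X n \<in> \<Omega>) \<and> X \<longlonglongrightarrow> x" using x by (simp only: closure_sequential)
        then obtain X where X: "\<And>n. X n \<in> \<Omega>" "X \<longlonglongrightarrow> x" by auto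
        have "X n \<in> closure \<Omega>" for n using X(1)[of n] closure_subset[of \<Omega>] by auto
        then have "(\<lambda>n. u (X n)) \<longlonglongrightarrow> u x"
          by (intro continuous_on_tendsto_compose[OF contu X(2) x]) simp
        then have "(\<lambda>n. \<bar>u (X n) - u y\<bar>) \<longlonglongrightarrow> \<bar>u x - u y\<bar>" by (intro tendsto_intros)
        moreover have "(\<lambda>n. s * norm (X n - y)) \<longlonglongrightarrow> s * norm (x - y)" using X(2) by (intro tendsto_intros)
        ultimately show ?thesis by (rule LIMSEQ_le) (use 1[OF X(1) y] in auto)
      qed
      have 3: "u y - u x \<le> s * norm (y - x)" if x: "x \<in> \<Omega>" and y: "y \<in> \<Omega>" for x y
      proof -
        have "u (x + (y - x)) - u x \<le> s * norm (y - x)"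
        proof (rule minimizer_translation_bound[where a = a, OF op bd _ assms(6) min fin])
          fix z assume z: "z \<in> closure \<Omega>" "z + (y - x) \<in> closure \<Omega>"
            "z \<in> frontier \<Omega> \<or> z + (y - x) \<in> frontier \<Omega>"
          have "\<bar>u (z + (y - x)) - u z\<bar> \<le> s * norm (y - x)"
            using z(3) 2[OF z(2), of z] 2[OF z(1), of "z + (y - x)"]
            by (auto simp: abs_minus_commute norm_minus_commute)
          then show "u (z + (y - x)) - u z \<le> s * norm (y - x)" by linarith
        qed (use a x y in auto)
        then show ?thesis by simp
      qed
      have 4: "\<bar>u x - u y\<bar> \<le> s * norm (x - y)" if "x \<in> \<Omega>" "y \<in> \<Omega>" for x y
        using 3[OF that] 3[OF that(2,1)] by (simp add: abs_le_iff norm_minus_commute)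
      then show "s-lipschitz_on \<Omega> u" using s0 by (intro lipschitz_onI) (auto simp: dist_norm)
      show "Lip_const \<Omega> u \<le> ereal s"
        unfolding Lip_const_def using 4 by (intro Sup_least) (auto simp: slope_le_iff simp del: ereal_less_eq)
    qed
    have S0: "S \<noteq> -\<infinity>"
    proof -
      have "ereal (\<bar>u x0 - g y0\<bar> / norm (x0 - y0)) \<le> S"
        unfolding S_def boundary_slope_def using x0 y0 frO by (intro Sup_upper) blast
      then show ?thesis by auto
    qed
    have "Lip_const \<Omega> u \<le> S"
      using Lip_le S0 by (cases S) auto
    moreover have "S \<le> Lip_const \<Omega> u"
    proof (cases "Lip_const \<Omega> u")
      case (real l)
      have l: "\<bar>u x - u y\<bar> \<le> l * norm (x - y)" if "x \<in> \<Omega>" "y \<in> \<Omega>" for x y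
      proof (cases "x = y")
        case False
        have "ereal (\<bar>u x - u y\<bar> / norm (x - y)) \<le> Lip_const \<Omega> u"
          unfolding Lip_const_def using that False by (intro Sup_upper) blast
        then show ?thesis using slope_le_iff[OF False] real by simp
      qed simp
      have "0 \<le> l * norm (x1 - x0)" using l[OF x1(1) x0] by (rule order_trans[rotated]) simp
      then have "l \<ge> 0" using x1 by (simp add: zero_le_mult_iff)
      then have "l-lipschitz_on \<Omega> u" using l by (intro lipschitz_onI) (auto simp: dist_norm)
      \<comment> \<open>An interior Lipschitz bound extends to the closure by continuity, and on the
        frontier \<open>u\<close> equals \<open>g\<close>, so it bounds the slopes to the
        boundary.\<close>
      then have lc: "l-lipschitz_on (closure \<Omega>) u" using contu by (rule lipschitz_on_closure)
      show ?thesis unfolding S_def boundary_slope_def real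
      proof (rule Sup_least, clarify)
        fix x y assume xy: "x \<in> \<Omega>" "y \<in> frontier \<Omega>" "x \<noteq> y"
        have "\<bar>u x - u y\<bar> \<le> l * norm (x - y)"
          using lipschitz_onD[OF lc _ frO(2)[OF xy(2)], of x] xy(1) closure_subset by (auto simp: dist_norm)
        then show "ereal (\<bar>u x - g y\<bar> / norm (x - y)) \<le> ereal l"
          using slope_le_iff[OF xy(3)] ug[OF xy(2)] by simp
      qed
    next
      case MInf
      have "ereal (\<bar>u x1 - u x0\<bar> / norm (x1 - x0)) \<le> Lip_const \<Omega> u"
        unfolding Lip_const_def using x0 x1 by (intro Sup_upper) blast
      then show ?thesis using MInf by simp
    qed simp
    ultimately have eq: "Lip_const \<Omega> u = S" by (rule antisym)
    have "weak_solution a \<sigma> \<Omega> (\<lambda>_. lam) g u" if lt: "S < ereal \<sigma>"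
    proof -
      obtain s where s: "S = ereal s" using lt S0 by (cases S) auto
      show ?thesis
        by (rule minimizer_weak_solution[where a = a, OF op bd _ assms(9) min lip])
          (use a s lt in auto)
    qed
    then show ?thesis using eq by (simp add: S_def)
  qed
qed

end
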